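(* Let $\epsilon\in\mathbb{C}$ with $\operatorname{Re}(\epsilon)>B_\epsilon^{p_+p_-}$ and $\operatorname{Re}(\epsilon)\ne0$. For all $\lambda,\mu\in\mathbb{C}$, $m,n\in\mathbb{Z}$, $1\le r\le p_+$, $1\le s\le p_-$, the $\mathcal{M}(p_+,p_-)$ regularised quantum dimensions satisfy $$\operatorname{qdim}[\mathcal{F}^\epsilon_\lambda]\operatorname{qdim}[\mathcal{F}^\epsilon_\mu]=\sum_{j_+=0}^{p_+-1}\sum_{j_-=0}^{p_--1}\operatorname{qdim}[\mathcal{F}^\epsilon_{\lambda+\mu+j_+\alpha_++j_-\alpha_-}],$$ $$\operatorname{qdim}[\mathcal{I}^\epsilon_{r,s;n}]\operatorname{qdim}[\mathcal{F}^\epsilon_\mu]=\sum_{j_+=0}^{r-1}\sum_{j_-=0}^{s-1}\operatorname{qdim}[\mathcal{F}^\epsilon_{\mu+\alpha_{r-2j_+,s-2j_-;n}}],$$ $$\operatorname{qdim}[\mathcal{I}^\epsilon_{1,1;m}]\operatorname{qdim}[\mathcal{I}^\epsilon_{r,s;n}]=\operatorname{qdim}[\mathcal{I}^\epsilon_{r,s;m+n}],$$ $$\operatorname{qdim}[\mathcal{I}^\epsilon_{2,1;0}]\operatorname{qdim}[\mathcal{I}^\epsilon_{r,s;n}]=\begin{cases}\operatorname{qdim}[\mathcal{I}^\epsilon_{2,s;n}]& r=1,\\ \operatorname{qdim}[\mathcal{I}^\epsilon_{r-1,s;n}]+\operatorname{qdim}[\mathcal{I}^\epsilon_{r+1,s;n}]&1<r<p_+,\\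 \operatorname{qdim}[\mathcal{I}^\epsilon_{1,s;n-1}]+2\operatorname{qdim}[\mathcal{I}^\epsilon_{p_+-1,s;n}]+\operatorname{qdim}[\mathcal{I}^\epsilon_{1,s;n+1}]&r=p_+,\end{cases}$$ $$\operatorname{qdim}[\mathcal{I}^\epsilon_{1,2;0}]\operatorname{qdim}[\mathcal{I}^\epsilon_{r,s;n}]=\begin{cases}\operatorname{qdim}[\mathcal{I}^\epsilon_{r,2;n}]& s=1,\\ \operatorname{qdim}[\mathcal{I}^\epsilon_{r,s-1;n}]+\operatorname{qdim}[\mathcal{I}^\epsilon_{r,s+1;n}]&1<s<p_-,\\ \operatorname{qdim}[\mathcal{I}^\epsilon_{r,1;n-1}]+2\operatorname{qdim}[\mathcal{I}^\epsilon_{r,p_--1;n}]+\operatorname{qdim}[\mathcal{I}^\epsilon_{r,1;n+1}]&s=p_-.\end{cases}$$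
   Context: Let $p_+,p_-\ge2$ be coprime integers, $\alpha_+=\sqrt{2p_-/p_+}$, $\alpha_-=-\sqrt{2p_+/p_-}$, $\alpha_0=\alpha_++\alpha_-$, $\alpha=\sqrt{2p_+p_-}$, and, for all integers $r,s,n$, $\alpha_{r,s;n}=\frac{1-r}{2}\alpha_++\frac{1-s}{2}\alpha_-+\frac n2\alpha$. Put $q=e^{2\pi i\tau}$ (with $q^x:=e^{2\pi i\tau x}$), $\eta$ the Dedekind eta function, $\theta_{a,b}(\tau)=\sum_{k\in\mathbb{Z}}q^{a(k+\frac{b}{2a})^2}$. The singlet vertex operator algebra $\mathcal{M}(p_+,p_-)$ is the intersection of the kernels of two commuting screening operators on the Heisenberg Fock module $\mathcal{F}_0$; its modules include the Fock modules $\mathcal{F}_\lambda$, irreducible submodules $\mathcal{I}_{r,s;n}$ of Fock modules, Virasoro minimal model modules $\mathcal{L}_{r,s}$, and the vacuum module $\mathcal{K}_{1,1;0}$. Only regularised characters enter: Fock: $\mathrm{ch}[\mathcal{F}^\epsilon_\lambda](\tau)=e^{2\pi\epsilon(\lambda-\alpha_0/2)}q^{(\lambda-\alpha_0/2)^2/2}/\eta(\tau)$, with $\mathcal{F}^\epsilon_{r,s;n}:=\mathcal{F}^\epsilon_{\alpha_{r,s;n}}$. Minimal models (not regularised), $1\le r<p_+$, $1\le s<p_-$: $\mathrm{ch}[\mathcal{L}_{r,s}]=\bigl(\theta_{p_+p_-,rp_--sp_+}-\theta_{p_+p_-,rp_-+sp_+}\bigr)/\eta$. For $1\le r<p_+$,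 $1\le s<p_-$: $\mathrm{ch}[\mathcal{I}^\epsilon_{r,s;n}]=n\,\delta_{n\ge0}\bigl(\delta_{n\text{ even}}\mathrm{ch}[\mathcal{L}_{r,s}]-\delta_{n\text{ odd}}\mathrm{ch}[\mathcal{L}_{r,p_--s}]\bigr)+\sum_{k\ge0}(k+1)\bigl(\mathrm{ch}[\mathcal{F}^\epsilon_{p_+-r,s;n-2k-1}]+\mathrm{ch}[\mathcal{F}^\epsilon_{r,p_--s;n-2k-3}]-\mathrm{ch}[\mathcal{F}^\epsilon_{r,s;n-2k-2}]-\mathrm{ch}[\mathcal{F}^\epsilon_{p_+-r,p_--s;n-2k-2}]\bigr)$. Border cases: $\mathrm{ch}[\mathcal{I}^\epsilon_{r,p_-;n}]=\sum_{k\ge0}\bigl(\mathrm{ch}[\mathcal{F}^\epsilon_{p_+-r,p_-;n-2k-1}]-\mathrm{ch}[\mathcal{F}^\epsilon_{r,p_-;n-2k-2}]\bigr)$ for $1\le r<p_+$; $\mathrm{ch}[\mathcal{I}^\epsilon_{p_+,s;n}]=\sum_{k\ge0}\bigl(\mathrm{ch}[\mathcal{F}^\epsilon_{p_+,s;n-2k}]-\mathrm{ch}[\mathcal{F}^\epsilon_{p_+,p_--s;n-2k-1}]\bigr)$ for $1\le s<p_-$; $\mathrm{ch}[\mathcal{I}^\epsilon_{p_+,p_-;n}]=\mathrm{ch}[\mathcal{F}^\epsilon_{p_+,p_-;n}]$. Vacuum: $\mathrm{ch}[\mathcal{K}^\epsilon_{1,1;0}]=\mathrm{ch}[\mathcal{L}_{1,1}]+\mathrm{ch}[\mathcal{I}^\epsilon_{1,1;0}]$.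 Regularised quantum dimension: $\operatorname{qdim}[M^\epsilon]=\lim_{y\to0^+}\mathrm{ch}[M^\epsilon](iy)/\mathrm{ch}[\mathcal{K}^\epsilon_{1,1;0}](iy)$. $B_\epsilon^{p_+p_-}=-\min\{|\frac{m}{\sqrt{2p_+p_-}}-\operatorname{Im}(\epsilon)|:m\in\mathbb{Z}\setminus p_+p_-\mathbb{Z}\}$. *)

theory Defs
  imports "HOL-Analysis.Analysis"
begin

text \<open>
  Throughout, \<open>pp\<close> and \<open>pm\<close> are the two coprime integers (written p with subscript + and p with
  subscript -) that parametrise the singlet vertex operator algebra. Modules are represented by
  their (regularised) characters, which are functions of the modular parameter \<open>\<tau>\<close> in the upper
  half plane. All labels are integers, since labels such as \<open>r - 2 * j\<close> may be negative.
\<close>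

definition alpha_plus :: "int \<Rightarrow> int \<Rightarrow> real" where
  "alpha_plus pp pm = sqrt (2 * real_of_int pm / real_of_int pp)"

definition alpha_minus :: "int \<Rightarrow> int \<Rightarrow> real" where
  "alpha_minus pp pm = - sqrt (2 * real_of_int pp / real_of_int pm)"

definition alpha_zero :: "int \<Rightarrow> int \<Rightarrow> real" where
  "alpha_zero pp pm = alpha_plus pp pm + alpha_minus pp pm"

definition alpha_full :: "int \<Rightarrow> int \<Rightarrow> real" where
  "alpha_full pp pm = sqrt (2 * real_of_int pp * real_of_int pm)"

definition alpha_rsn :: "int \<Rightarrow> int \<Rightarrow> int \<Rightarrow> int \<Rightarrow> int \<Rightarrow> real" where
  "alpha_rsn pp pm r s n =
     (1 - real_of_int r) / 2 * alpha_plus pp pm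
     + (1 - real_of_int s) / 2 * alpha_minus pp pm
     + real_of_int n / 2 * alpha_full pp pm"

text \<open>The power of \<open>q = exp (2 \<pi> i \<tau>)\<close> with a complex exponent, with the branch fixed by \<open>\<tau>\<close>.\<close>

definition qpow :: "complex \<Rightarrow> complex \<Rightarrow> complex" where
  "qpow \<tau> x = exp (2 * complex_of_real pi * \<i> * \<tau> * x)"

definition dedekind_eta :: "complex \<Rightarrow> complex" where
  "dedekind_eta \<tau> = qpow \<tau> (1 / 24) * prodinf (\<lambda>n::nat. 1 - qpow \<tau> (of_nat (n + 1)))"

definition theta :: "int \<Rightarrow> int \<Rightarrow> complex \<Rightarrow> complex" where
  "theta a b \<tau> =
     (\<Sum>\<^sub>\<infinity>k\<in>(UNIV :: int set). qpow \<tau> (of_int a * (of_int k + of_int b / (2 * of_int a))\<^sup>2))"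

definition ch_Fock :: "int \<Rightarrow> int \<Rightarrow> complex \<Rightarrow> complex \<Rightarrow> complex \<Rightarrow> complex" where
  "ch_Fock pp pm \<epsilon> l \<tau> =
     exp (2 * complex_of_real pi * \<epsilon> * (l - complex_of_real (alpha_zero pp pm) / 2))
     * qpow \<tau> ((l - complex_of_real (alpha_zero pp pm) / 2)\<^sup>2 / 2) / dedekind_eta \<tau>"

definition ch_Fock_rsn ::
    "int \<Rightarrow> int \<Rightarrow> complex \<Rightarrow> int \<Rightarrow> int \<Rightarrow> int \<Rightarrow> complex \<Rightarrow> complex" where
  "ch_Fock_rsn pp pm \<epsilon> r s n = ch_Fock pp pm \<epsilon> (complex_of_real (alpha_rsn pp pm r s n))"

definition ch_minimal :: "int \<Rightarrow> int \<Rightarrow> int \<Rightarrow> int \<Rightarrow> complex \<Rightarrow> complex" where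
  "ch_minimal pp pm r s \<tau> =
     (theta (pp * pm) (r * pm - s * pp) \<tau> - theta (pp * pm) (r * pm + s * pp) \<tau>)
     / dedekind_eta \<tau>"

text \<open>
  Only meant for \<open>1 \<le> r \<le> pp\<close> and \<open>1 \<le> s \<le> pm\<close>. The last branch is then \<open>r = pp\<close>, \<open>s = pm\<close>.
\<close>

definition ch_I :: "int \<Rightarrow> int \<Rightarrow> complex \<Rightarrow> int \<Rightarrow> int \<Rightarrow> int \<Rightarrow> complex \<Rightarrow> complex" where
  "ch_I pp pm \<epsilon> r s n \<tau> =
     (if r < pp \<and> s < pm then
        of_int n * of_bool (n \<ge> 0)
          * (of_bool (even n) * ch_minimal pp pm r s \<tau>
             - of_bool (odd n) * ch_minimal pp pm r (pm - s) \<tau>)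
        + (\<Sum>k::nat. of_nat (k + 1) *
             (ch_Fock_rsn pp pm \<epsilon> (pp - r) s (n - 2 * int k - 1) \<tau>
              + ch_Fock_rsn pp pm \<epsilon> r (pm - s) (n - 2 * int k - 3) \<tau>
              - ch_Fock_rsn pp pm \<epsilon> r s (n - 2 * int k - 2) \<tau>
              - ch_Fock_rsn pp pm \<epsilon> (pp - r) (pm - s) (n - 2 * int k - 2) \<tau>))
      else if r < pp then
        (\<Sum>k::nat. ch_Fock_rsn pp pm \<epsilon> (pp - r) pm (n - 2 * int k - 1) \<tau>
                  - ch_Fock_rsn pp pm \<epsilon> r pm (n - 2 * int k - 2) \<tau>)
      else if s < pm then
        (\<Sum>k::nat. ch_Fock_rsn pp pm \<epsilon> pp s (n - 2 * int k) \<tau>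
                  - ch_Fock_rsn pp pm \<epsilon> pp (pm - s) (n - 2 * int k - 1) \<tau>)
      else ch_Fock_rsn pp pm \<epsilon> pp pm n \<tau>)"

definition ch_vacuum :: "int \<Rightarrow> int \<Rightarrow> complex \<Rightarrow> complex \<Rightarrow> complex" where
  "ch_vacuum pp pm \<epsilon> \<tau> = ch_minimal pp pm 1 1 \<tau> + ch_I pp pm \<epsilon> 1 1 0 \<tau>"

definition qdim_ratio ::
    "int \<Rightarrow> int \<Rightarrow> complex \<Rightarrow> (complex \<Rightarrow> complex) \<Rightarrow> real \<Rightarrow> complex" where
  "qdim_ratio pp pm \<epsilon> ch y =
     ch (\<i> * complex_of_real y) / ch_vacuum pp pm \<epsilon> (\<i> * complex_of_real y)"

text \<open>
  \<open>Lim\<close> is a total operator and division by zero yields zero, so that the defining limit is a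
  genuine one is recorded separately.
\<close>

definition qdim_exists :: "int \<Rightarrow> int \<Rightarrow> complex \<Rightarrow> (complex \<Rightarrow> complex) \<Rightarrow> bool" where
  "qdim_exists pp pm \<epsilon> ch \<longleftrightarrow>
     (\<forall>\<^sub>F y in at_right 0. ch_vacuum pp pm \<epsilon> (\<i> * complex_of_real y) \<noteq> 0) \<and>
     (\<exists>L. (qdim_ratio pp pm \<epsilon> ch \<longlongrightarrow> L) (at_right 0))"

definition qdim :: "int \<Rightarrow> int \<Rightarrow> complex \<Rightarrow> (complex \<Rightarrow> complex) \<Rightarrow> complex" where
  "qdim pp pm \<epsilon> ch = Lim (at_right 0) (qdim_ratio pp pm \<epsilon> ch)"

definition qdim_Fock :: "int \<Rightarrow> int \<Rightarrow> complex \<Rightarrow> complex \<Rightarrow> complex" where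
  "qdim_Fock pp pm \<epsilon> l = qdim pp pm \<epsilon> (ch_Fock pp pm \<epsilon> l)"

definition qdim_I :: "int \<Rightarrow> int \<Rightarrow> complex \<Rightarrow> int \<Rightarrow> int \<Rightarrow> int \<Rightarrow> complex" where
  "qdim_I pp pm \<epsilon> r s n = qdim pp pm \<epsilon> (ch_I pp pm \<epsilon> r s n)"

text \<open>The set is nonempty, closed and bounded below, so the infimum is a minimum.\<close>

definition B_bound :: "int \<Rightarrow> int \<Rightarrow> complex \<Rightarrow> real" where
  "B_bound pp pm \<epsilon> =
     - Inf {\<bar>real_of_int m / sqrt (2 * real_of_int pp * real_of_int pm) - Im \<epsilon>\<bar> |m::int.
              \<not> pp * pm dvd m}"

end

theory Submission
  imports Defs "HOL-Probability.Probability" "HOL-Complex_Analysis.Complex_Analysis"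
    "HOL-Real_Asymp.Real_Asymp"
begin

text \<open>
  Write \<open>P = pp * pm\<close>, so that \<open>\<alpha>\<^sup>2 = 2 * P\<close>, and put \<open>u = exp (2 * \<pi> * \<epsilon> / \<alpha>)\<close>, \<open>v = u ^ pm\<close>, \<open>w = u ^ pp\<close>. The Fock
  module with labels \<open>r, s, n\<close> has the weight \<open>alpha_zero / 2 + N / \<alpha>\<close> with the integer \<open>N = n * P - r * pm + s * pp\<close>, and on
  \<open>\<tau> = i * y\<close> its character times \<open>\<eta>\<close> is the damped power \<open>u ^ N * exp (- \<pi> * y * (N / \<alpha>)\<^sup>2)\<close>. If the
  damping is dropped, the four-term sum for the module \<open>I\<close> is, for \<open>Re \<epsilon> > 0\<close>, an
  arithmetic-geometric series with value
  \<open>H(\<epsilon>) = u ^ (n * P) * [r]_v * [s]_w / ([pp]_v * [pm]_w)\<close>, where \<open>[k]_x\<close> is the symmetric q-number. Once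
  it is known that \<open>\<eta> * ch[I]\<close> tends to \<open>H(\<epsilon>)\<close> as \<open>y\<close> tends to 0, quotients by the vacuum (the case
  \<open>r = s = 1\<close>, \<open>n = 0\<close>) give \<open>qdim[I] = u ^ (n * P) * [r]_v * [s]_w\<close>, and all fusion rules become
  identities between q-numbers.

  For \<open>Re \<epsilon> < 0\<close> the undamped series diverges, and the limit has to be obtained by continuation. The
  damped sum is, for every \<open>\<epsilon>\<close>, the mean of \<open>H\<close> over a vertical line \<open>Re z = a > 0\<close> against the Gaussian
  kernel \<open>exp (\<pi> * (z - \<epsilon>)\<^sup>2 / y)\<close> (\<open>irr_term_sums_gauss_mean\<close>). This kernel is concentrated at \<open>\<epsilon>\<close>, but
  small only where \<open>\<bar>Im (z - \<epsilon>)\<bar> > \<bar>Re (z - \<epsilon>)\<bar>\<close>. So the middle part of the line is pulled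
  back to two segments meeting at \<open>\<epsilon>\<close>, by Cauchy's theorem on a triangle, and the mean tends to \<open>H(\<epsilon>)\<close>
  provided that the triangle contains no pole of \<open>H\<close> (\<open>gauss_mean_tendsto\<close>). The poles are among the
  points \<open>i * m / \<alpha>\<close> with \<open>m\<close> not divisible by \<open>P\<close>, since the other zeros of the denominator
  \<open>(u ^ P - u ^ (- P))\<^sup>2\<close> cancel against the numerator. These points stay outside the triangle, once its
  sides are close enough to the diagonals through \<open>\<epsilon>\<close>, precisely when \<open>Re \<epsilon>\<close> exceeds the bound \<open>B\<close>.

  The remaining characters reduce to this one sum. The border cases are the interior formula at
  \<open>r = pp\<close> or \<open>s = pm\<close>, summed by parts. The theta functions of the minimal models are, again by parts, a
  difference of two such sums at \<open>\<epsilon> = 0\<close> with equal limits, so that the minimal model contributions vanish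
  in the limit.
\<close>

section \<open>Gaussian means along vertical lines\<close>

text \<open>
  The value does not depend on the line, nor on the centre \<open>w\<close>: completing the square, this is the
  Fourier transform of a normal density, that is, the characteristic function of the standard normal
  distribution after rescaling by \<open>\<sigma>\<close>.
\<close>

lemma gaussian_line:
  fixes a y :: real and w :: complex
  assumes y: "y > 0"
  shows "has_bochner_integral lborel (\<lambda>t. exp (of_real pi * (Complex a t - w)\<^sup>2 / of_real y))
           (complex_of_real (sqrt y))"
proof -
  define c where "c = a - Re w"
  define \<sigma> where "\<sigma> = sqrt (2 * pi / y)"
  have \<sigma>: "\<sigma> > 0" "\<sigma>\<^sup>2 = 2 * pi / y"
    using y by (simp_all add: \<sigma>_def)
  define X where "X = c * \<sigma>"
  have X: "X\<^sup>2 = 2 * pi * c\<^sup>2 / y" by (simp add: X_def power_mult_distrib \<sigma>)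
  have int: "integrable lborel (\<lambda>s. std_normal_density s *\<^sub>R iexp (X * s))"
    by (rule Bochner_Integration.integrable_bound[OF integrable_normal_density[of 1 0]]) auto
  have val: "(LINT s|lborel. std_normal_density s *\<^sub>R iexp (X * s)) = of_real (exp (- (X\<^sup>2) / 2))"
  proof -
    have "char std_normal_distribution X = of_real (exp (- (X\<^sup>2) / 2))"
      by (simp add: char_std_normal_distribution)
    thus ?thesis unfolding char_def
      by (subst (asm) integral_density) auto
  qed
  have 1: "has_bochner_integral lborel (\<lambda>s. std_normal_density s *\<^sub>R iexp (X * s))
             (complex_of_real (exp (- (X\<^sup>2) / 2)))"
    using int val by (simp add: has_bochner_integral_iff)
  have 2: "has_bochner_integral lborel
       (\<lambda>t. std_normal_density (- Im w * \<sigma> + \<sigma> * t) *\<^sub>R iexp (X * (- Im w * \<sigma> + \<sigma> * t)))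
         (complex_of_real (exp (- (X\<^sup>2) / 2)) /\<^sub>R \<bar>\<sigma>\<bar>)"
    using lborel_has_bochner_integral_real_affine_iff[of \<sigma> "\<lambda>s. std_normal_density s *\<^sub>R iexp (X * s)"
        "complex_of_real (exp (- (X\<^sup>2) / 2))" "- Im w * \<sigma>"] 1 \<sigma> by simp
  have 3: "has_bochner_integral lborel
       (\<lambda>t. of_real (sqrt (2 * pi) * exp (X\<^sup>2 / 2)) *
           (std_normal_density (- Im w * \<sigma> + \<sigma> * t) *\<^sub>R iexp (X * (- Im w * \<sigma> + \<sigma> * t))))
         (of_real (sqrt (2 * pi) * exp (X\<^sup>2 / 2)) * (complex_of_real (exp (- (X\<^sup>2) / 2)) /\<^sub>R \<bar>\<sigma>\<bar>))"
    by (rule has_bochner_integral_mult_right) (use 2 in auto)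
  have eq1: "of_real (sqrt (2 * pi) * exp (X\<^sup>2 / 2)) *
           (std_normal_density (- Im w * \<sigma> + \<sigma> * t) *\<^sub>R iexp (X * (- Im w * \<sigma> + \<sigma> * t)))
      = exp (of_real pi * (Complex a t - w)\<^sup>2 / of_real y)" (is "?l = ?r") for t
  proof -
    define s where "s = t - Im w"
    have z: "Complex a t - w = of_real c + \<i> * of_real s"
      by (simp add: complex_eq_iff c_def s_def)
    have st: "- Im w * \<sigma> + \<sigma> * t = \<sigma> * s" by (simp add: s_def algebra_simps)
    have "?l = of_real (exp (X\<^sup>2 / 2) * exp (- (\<sigma> * s)\<^sup>2 / 2)) * iexp (X * (\<sigma> * s))"
      unfolding st by (simp add: std_normal_density_def scaleR_conv_of_real)
    also have "\<dots> = exp (of_real (X\<^sup>2 / 2 - (\<sigma> * s)\<^sup>2 / 2) + \<i> * of_real (X * (\<sigma> * s)))"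
      by (simp only: exp_of_real [symmetric] of_real_mult exp_add [symmetric] of_real_add of_real_diff)
         (simp add: mult_exp_exp)
    also have "of_real (X\<^sup>2 / 2 - (\<sigma> * s)\<^sup>2 / 2) + \<i> * of_real (X * (\<sigma> * s))
       = of_real pi * (of_real c + \<i> * of_real s)\<^sup>2 / complex_of_real y"
    proof -
      have "X\<^sup>2 / 2 - (\<sigma> * s)\<^sup>2 / 2 = pi * (c\<^sup>2 - s\<^sup>2) / y"
        by (simp add: X power_mult_distrib \<sigma> algebra_simps diff_divide_distrib)
      moreover have "X * (\<sigma> * s) = 2 * pi * c * s / y"
      proof -
        have "X * (\<sigma> * s) = c * s * \<sigma>\<^sup>2" by (simp add: X_def power2_eq_square)
        thus ?thesis by (simp add: \<sigma>)
      qed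
      ultimately show ?thesis
        by (simp add: complex_eq_iff power2_eq_square algebra_simps)
    qed
    finally show ?thesis unfolding z .
  qed
  have eq2: "of_real (sqrt (2 * pi) * exp (X\<^sup>2 / 2)) * (complex_of_real (exp (- (X\<^sup>2) / 2)) /\<^sub>R \<bar>\<sigma>\<bar>)
      = complex_of_real (sqrt y)"
  proof -
    have "sqrt (2 * pi) / \<sigma> = sqrt y"
      using y by (simp add: \<sigma>_def real_sqrt_divide)
    moreover have "exp (X\<^sup>2 / 2) * exp (- (X\<^sup>2) / 2) = 1"
      by (simp flip: exp_add)
    ultimately have "sqrt (2 * pi) * exp (X\<^sup>2 / 2) * (exp (- (X\<^sup>2) / 2) / \<sigma>) = sqrt y"
      by (metis (no_types, opaque_lifting) mult.assoc mult.right_neutral times_divide_eq_left times_divide_eq_right)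
    hence "complex_of_real (sqrt (2 * pi) * exp (X\<^sup>2 / 2) * (exp (- (X\<^sup>2) / 2) / \<sigma>)) = complex_of_real (sqrt y)"
      by (rule arg_cong)
    moreover have "complex_of_real (exp (- (X\<^sup>2) / 2)) /\<^sub>R \<bar>\<sigma>\<bar> = of_real (exp (- (X\<^sup>2) / 2) / \<sigma>)"
      unfolding scaleR_conv_of_real of_real_mult [symmetric]
      using \<sigma>(1) by (simp add: field_simps)
    ultimately show ?thesis by (simp only: of_real_mult)
  qed
  show ?thesis using 3 unfolding eq1 eq2 .
qed

text \<open>
  Normalised so that constants are reproduced. The kernel is entire in \<open>z\<close>, which is what allows the line to be
  deformed when \<open>H\<close> is holomorphic.
\<close>

definition gauss_mean :: "complex \<Rightarrow> real \<Rightarrow> (complex \<Rightarrow> complex) \<Rightarrow> real \<Rightarrow> complex" where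
  "gauss_mean \<epsilon> a H y =
     (LINT t|lborel. exp (of_real pi * (Complex a t - \<epsilon>)\<^sup>2 / of_real y) * H (Complex a t)) / of_real (sqrt y)"

definition gauss_term :: "complex \<Rightarrow> real \<Rightarrow> real \<Rightarrow> complex" where
  "gauss_term \<epsilon> y x = exp (2 * of_real pi * \<epsilon> * of_real x - of_real (pi * y * x\<^sup>2))"

text \<open>
  A Gaussian mean turns a pure exponential into a damped one. The centre of the Gaussian moves from \<open>\<epsilon>\<close> to
  \<open>\<epsilon> - y * x\<close>, and the completed square leaves the factor \<open>exp (- \<pi> * y * x\<^sup>2)\<close>.
\<close>

lemma gauss_transform_exp:
  fixes a y x :: real and \<epsilon> :: complex
  assumes y: "y > 0"
  shows "has_bochner_integral lborel
           (\<lambda>t. exp (of_real pi * (Complex a t - \<epsilon>)\<^sup>2 / of_real y) * exp (2 * of_real pi * Complex a t * of_real x))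
           (of_real (sqrt y) * gauss_term \<epsilon> y x)"
proof -
  have eq: "gauss_term \<epsilon> y x * exp (of_real pi * (Complex a t - (\<epsilon> - of_real (y * x)))\<^sup>2 / of_real y)
     = exp (of_real pi * (Complex a t - \<epsilon>)\<^sup>2 / of_real y) * exp (2 * of_real pi * Complex a t * of_real x)" for t
    unfolding gauss_term_def mult_exp_exp
    using y by (intro arg_cong[of _ _ exp]) (simp add: power2_eq_square field_simps)
  have "has_bochner_integral lborel (\<lambda>t. gauss_term \<epsilon> y x * exp (of_real pi * (Complex a t - (\<epsilon> - of_real (y * x)))\<^sup>2 / of_real y))
     (gauss_term \<epsilon> y x * of_real (sqrt y))"
    by (rule has_bochner_integral_mult_right) (use gaussian_line[OF y] in auto)
  thus ?thesis unfolding eq by (simp add: mult.commute)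
qed

lemma norm_gauss_kernel:
  "norm (exp (of_real pi * (z - \<epsilon>)\<^sup>2 / of_real y)) = exp (pi * ((Re (z - \<epsilon>))\<^sup>2 - (Im (z - \<epsilon>))\<^sup>2) / y)"
  by (simp add: power2_eq_square algebra_simps)

text \<open>
  Convergence is required on the line \<open>Re z = a\<close> only, while \<open>\<epsilon>\<close> is arbitrary. This is how a damped sum
  whose undamped version diverges at \<open>\<epsilon>\<close> becomes accessible.
\<close>

lemma gauss_transform_series:
  fixes a y :: real and \<epsilon> :: complex and c :: "nat \<Rightarrow> complex" and x :: "nat \<Rightarrow> real"
  assumes y: "y > 0" and sm: "summable (\<lambda>k. norm (c k) * exp (2 * pi * a * x k))"
    and h: "\<And>t. h (Complex a t) = (\<Sum>k. c k * exp (2 * of_real pi * Complex a t * of_real (x k)))"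
  shows "integrable lborel (\<lambda>t. exp (of_real pi * (Complex a t - \<epsilon>)\<^sup>2 / of_real y) * h (Complex a t))" (is ?A)
    and "(\<lambda>k. c k * gauss_term \<epsilon> y (x k)) sums gauss_mean \<epsilon> a h y" (is ?B)
proof -
  define E where "E = (\<lambda>t. exp (of_real pi * (Complex a t - \<epsilon>)\<^sup>2 / of_real y))"
  define f where "f = (\<lambda>k t. c k * (E t * exp (2 * of_real pi * Complex a t * of_real (x k))))"
  have f: "has_bochner_integral lborel (f k) (c k * (of_real (sqrt y) * gauss_term \<epsilon> y (x k)))" for k
    unfolding f_def E_def
    by (rule has_bochner_integral_mult_right) (use gauss_transform_exp[OF y] in auto)
  have E: "integrable lborel E"
    using gaussian_line[OF y, of a \<epsilon>] by (simp add: E_def has_bochner_integral_iff)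
  have nf: "norm (f k t) = norm (c k) * exp (2 * pi * a * x k) * norm (E t)" for k t
    by (simp add: f_def norm_mult)
  have fi: "integrable lborel (f k)" for k using f by (simp add: has_bochner_integral_iff)
  have s1: "AE t in lborel. summable (\<lambda>k. norm (f k t))"
    unfolding nf by (intro AE_I2 summable_mult2 sm)
  have s2: "summable (\<lambda>k. LINT t|lborel. norm (f k t))"
    unfolding nf by (simp add: summable_mult2[OF sm])
  have eq: "(\<Sum>k. f k t) = E t * h (Complex a t)" for t
  proof -
    have "summable (\<lambda>k. norm (c k * exp (2 * of_real pi * Complex a t * of_real (x k))))"
      using sm by (simp add: norm_mult)
    hence "summable (\<lambda>k. c k * exp (2 * of_real pi * Complex a t * of_real (x k)))"
      by (rule summable_norm_cancel)
    from suminf_mult[OF this, of "E t"] show ?thesis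
      by (simp add: f_def h mult_ac)
  qed
  show ?A using integrable_suminf[OF fi s1 s2] by (simp add: eq E_def)
  have "(\<lambda>k. integral\<^sup>L lborel (f k)) sums (LINT t|lborel. E t * h (Complex a t))"
    using sums_integral[OF fi s1 s2] by (simp add: eq)
  hence "(\<lambda>k. integral\<^sup>L lborel (f k) / of_real (sqrt y)) sums gauss_mean \<epsilon> a h y"
    unfolding gauss_mean_def E_def by (rule sums_divide)
  moreover have "integral\<^sup>L lborel (f k) / of_real (sqrt y) = c k * gauss_term \<epsilon> y (x k)" for k
    using f[of k] y by (simp add: has_bochner_integral_iff)
  ultimately show ?B by simp
qed


lemma gaussian_line_real:
  fixes y b :: real
  assumes "y > 0"
  shows "has_bochner_integral lborel (\<lambda>t. exp (- (pi * (t - b)\<^sup>2 / y))) (sqrt y)"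
proof -
  have eq: "exp (of_real pi * (Complex 0 t - Complex 0 b)\<^sup>2 / of_real y)
      = complex_of_real (exp (- (pi * (t - b)\<^sup>2 / y)))" for t
  proof -
    have "of_real pi * (Complex 0 t - Complex 0 b)\<^sup>2 / complex_of_real y = of_real (- (pi * (t - b)\<^sup>2 / y))"
      by (simp add: complex_eq_iff power2_eq_square Re_divide Im_divide)
    thus ?thesis by (simp only: exp_of_real)
  qed
  have *: "has_bochner_integral lborel (\<lambda>t. complex_of_real (exp (- (pi * (t - b)\<^sup>2 / y)))) (of_real (sqrt y))"
    using gaussian_line[OF assms, of 0 "Complex 0 b"] unfolding eq .
  show ?thesis using has_bochner_integral_Re[OF *] by simp
qed

section \<open>Pulling the line of integration back to the centre\<close>

text \<open>
  On a segment steeper than the diagonal the kernel decays like \<open>exp (- \<pi> * A * t\<^sup>2 / y)\<close> in the parameter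
  \<open>t\<close>. A factor vanishing to first order at \<open>\<epsilon>\<close> then makes the integral \<open>O(y)\<close>, which beats the
  normalisation \<open>1 / sqrt y\<close> of the mean.
\<close>

lemma norm_integral_steep_segment:
  fixes \<epsilon> q :: complex and y L :: real
  defines "A \<equiv> (Im (q - \<epsilon>))\<^sup>2 - (Re (q - \<epsilon>))\<^sup>2"
  assumes y: "y > 0" and A: "A > 0" and cont: "continuous_on (closed_segment \<epsilon> q) K"
    and K: "\<And>z. z \<in> closed_segment \<epsilon> q \<Longrightarrow> norm (K z) \<le> L * norm (z - \<epsilon>)"
  shows "norm (contour_integral (linepath \<epsilon> q) (\<lambda>z. exp (of_real pi * (z - \<epsilon>)\<^sup>2 / of_real y) * K z))
          \<le> L * (norm (q - \<epsilon>))\<^sup>2 * (y / (2 * pi * A))"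
proof -
  define f where "f = (\<lambda>z. exp (of_real pi * (z - \<epsilon>)\<^sup>2 / of_real y) * K z)"
  have contf: "continuous_on (closed_segment \<epsilon> q) f"
    unfolding f_def using y by (intro continuous_intros cont) auto
  then have "(f has_contour_integral contour_integral (linepath \<epsilon> q) f) (linepath \<epsilon> q)"
    by (intro has_contour_integral_integral contour_integrable_continuous_linepath)
  then have I: "((\<lambda>s. f (linepath \<epsilon> q s) * (q - \<epsilon>)) has_integral contour_integral (linepath \<epsilon> q) f) {0..1}"
    by (simp add: has_contour_integral_linepath)
  define g where "g = (\<lambda>s. L * (norm (q - \<epsilon>))\<^sup>2 * (s * exp (- (pi * A * s\<^sup>2 / y))))"
  define G where "G = (\<lambda>s. - (y / (2 * pi * A)) * exp (- (pi * A * s\<^sup>2 / y)))"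
  have "((\<lambda>s. s * exp (- (pi * A * s\<^sup>2 / y))) has_integral G 1 - G 0) {0..1}"
  proof (rule fundamental_theorem_of_calculus)
    show "(G has_vector_derivative s * exp (- (pi * A * s\<^sup>2 / y))) (at s within {0..1})" for s
      unfolding has_real_derivative_iff_has_vector_derivative [symmetric] G_def
      using y A by (auto intro!: derivative_eq_intros simp: field_simps)
  qed simp
  then have J: "(g has_integral L * (norm (q - \<epsilon>))\<^sup>2 * (G 1 - G 0)) {0..1}"
    unfolding g_def by (rule has_integral_mult_right)
  have L: "0 \<le> L * (norm (q - \<epsilon>))\<^sup>2"
    using order_trans[OF norm_ge_zero K[of q]] by (simp add: power2_eq_square flip: mult.assoc)
  have bound: "norm (f (linepath \<epsilon> q s) * (q - \<epsilon>)) \<le> g s" if s: "s \<in> {0..1}" for s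
  proof -
    have z: "linepath \<epsilon> q s - \<epsilon> = of_real s * (q - \<epsilon>)"
      by (simp add: linepath_def scaleR_conv_of_real algebra_simps)
    have "linepath \<epsilon> q s \<in> closed_segment \<epsilon> q"
      using s linepath_in_path by blast
    from K[OF this] s have 1: "norm (K (linepath \<epsilon> q s)) \<le> L * (s * norm (q - \<epsilon>))"
      unfolding z by (simp add: norm_mult)
    have 2: "norm (exp (of_real pi * (linepath \<epsilon> q s - \<epsilon>)\<^sup>2 / of_real y)) = exp (- (pi * A * s\<^sup>2 / y))"
      unfolding norm_gauss_kernel z A_def
      by (simp add: power2_eq_square algebra_simps diff_divide_distrib add_divide_distrib)
    have "norm (f (linepath \<epsilon> q s) * (q - \<epsilon>))
      = exp (- (pi * A * s\<^sup>2 / y)) * norm (K (linepath \<epsilon> q s)) * norm (q - \<epsilon>)"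
      unfolding f_def norm_mult 2 ..
    also have "\<dots> \<le> exp (- (pi * A * s\<^sup>2 / y)) * (L * (s * norm (q - \<epsilon>))) * norm (q - \<epsilon>)"
      by (intro mult_right_mono mult_left_mono 1) auto
    also have "\<dots> = g s" by (simp add: g_def power2_eq_square)
    finally show ?thesis .
  qed
  have "norm (contour_integral (linepath \<epsilon> q) f) \<le> L * (norm (q - \<epsilon>))\<^sup>2 * (G 1 - G 0)"
    using integral_norm_bound_integral[OF has_integral_integrable[OF I] has_integral_integrable[OF J] bound]
    by (simp only: integral_unique[OF I] integral_unique[OF J])
  also have "\<dots> \<le> L * (norm (q - \<epsilon>))\<^sup>2 * (y / (2 * pi * A))"
  proof (intro mult_left_mono L)
    have "G 1 \<le> 0" using y A by (simp add: G_def)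
    thus "G 1 - G 0 \<le> y / (2 * pi * A)" by (simp add: G_def)
  qed
  finally show ?thesis unfolding f_def .
qed

text \<open>
  The centre \<open>\<epsilon>\<close> may lie far to the left of the line. Since constants are reproduced, \<open>H\<close> may be replaced
  by \<open>K = H - H(\<epsilon>)\<close>. On the part of the line above and below the cone
  \<open>\<kappa> * \<bar>Im (z - \<epsilon>)\<bar> \<le> Re (z - \<epsilon>)\<close> the kernel is exponentially small. The part inside is the
  third side of a triangle with apex \<open>\<epsilon>\<close> and is moved to the other two sides, where \<open>K\<close> vanishes at
  \<open>\<epsilon>\<close>. The slope \<open>\<kappa> < 1\<close> is what keeps these two sides inside the region of decay.
\<close>

lemma gauss_mean_tendsto:
  fixes H :: "complex \<Rightarrow> complex" and \<epsilon> :: complex and a \<kappa> M :: real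
  assumes a: "Re \<epsilon> < a" and \<kappa>: "0 < \<kappa>" "\<kappa> < 1"
    and hol: "H holomorphic_on U" and U: "open U"
    and tri: "\<And>z. Re z \<le> a \<Longrightarrow> \<kappa> * \<bar>Im z - Im \<epsilon>\<bar> \<le> Re z - Re \<epsilon> \<Longrightarrow> z \<in> U"
    and line: "\<And>t. Complex a t \<in> U" and bd: "\<And>t. norm (H (Complex a t)) \<le> M"
  shows "(gauss_mean \<epsilon> a H \<longlongrightarrow> H \<epsilon>) (at_right 0)"
proof -
  define b where "b = Im \<epsilon>"
  define c where "c = a - Re \<epsilon>"
  define T where "T = c / \<kappa>"
  define p where "p = Complex a (b - T)"
  define q where "q = Complex a (b + T)"
  \<comment> \<open>Half of the decay rate outside the cone; the other half makes the tail integral converge.\<close>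
  define \<delta> where "\<delta> = (1 - \<kappa>\<^sup>2) / 2"
  define K where "K = (\<lambda>z. H z - H \<epsilon>)"
  define M' where "M' = M + norm (H \<epsilon>)"
  have c: "c > 0" and T: "T > 0" and cT: "c = \<kappa> * T"
    using a \<kappa> by (simp_all add: c_def T_def)
  have \<kappa>2: "\<kappa>\<^sup>2 < 1" using \<kappa> by (simp add: power_less_one_iff)
  hence \<delta>: "\<delta> > 0" by (simp add: \<delta>_def)
  define W where "W = {z. Re z \<le> a \<and> \<kappa> * \<bar>Im z - Im \<epsilon>\<bar> \<le> Re z - Re \<epsilon>}"
  have convW: "convex W"
  proof -
    have "W = {z. inner (Complex 1 0) z \<le> a} \<inter> {z. inner (Complex (-1) \<kappa>) z \<le> \<kappa> * b - Re \<epsilon>}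
              \<inter> {z. inner (Complex (-1) (-\<kappa>)) z \<le> - \<kappa> * b - Re \<epsilon>}" (is "_ = ?V")
    proof (intro set_eqI)
      fix z
      have "\<kappa> * \<bar>Im z - Im \<epsilon>\<bar> = \<bar>\<kappa> * Im z - \<kappa> * Im \<epsilon>\<bar>"
        using \<kappa> by (simp add: abs_mult flip: right_diff_distrib)
      thus "z \<in> W \<longleftrightarrow> z \<in> ?V"
        by (auto simp: W_def inner_complex_def b_def algebra_simps abs_if split: if_splits)
    qed
    thus ?thesis by (simp only: convex_Int convex_halfspace_le)
  qed
  have hullW: "convex hull {p, \<epsilon>, q} \<subseteq> W"
    using c T \<kappa> by (intro hull_minimal convW) (auto simp: W_def p_def q_def b_def c_def cT[symmetric])
  have WU: "W \<subseteq> U" using tri by (auto simp: W_def)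
  define S where "S = convex hull {p, \<epsilon>, q}"
  have SU: "S \<subseteq> U" using hullW WU by (simp add: S_def)
  have S: "p \<in> S" "\<epsilon> \<in> S" "q \<in> S" "convex S" "compact S"
    by (auto simp: S_def hull_inc intro!: finite_imp_compact_convex_hull)
  have segs: "closed_segment \<epsilon> p \<subseteq> S" "closed_segment \<epsilon> q \<subseteq> S" "closed_segment p \<epsilon> \<subseteq> S"
      "closed_segment p q \<subseteq> S" "closed_segment q p \<subseteq> S" "closed_segment q \<epsilon> \<subseteq> S"
    using S by (simp_all add: closed_segment_subset)
  have KU: "K holomorphic_on U" unfolding K_def by (intro holomorphic_intros hol)
  have contK: "continuous_on S K"
    using KU SU holomorphic_on_imp_continuous_on holomorphic_on_subset by blast
  obtain L where L: "\<And>z. z \<in> S \<Longrightarrow> norm (K z) \<le> L * norm (z - \<epsilon>)"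
  proof -
    have "continuous_on S (deriv H)"
      using holomorphic_deriv[OF hol U] SU holomorphic_on_imp_continuous_on holomorphic_on_subset by blast
    hence "bounded (deriv H ` S)" using S(5) compact_continuous_image compact_imp_bounded by blast
    then obtain L where L: "\<And>z. z \<in> S \<Longrightarrow> norm (deriv H z) \<le> L"
      unfolding bounded_iff by auto
    have "norm (H z - H \<epsilon>) \<le> L * norm (z - \<epsilon>)" if "z \<in> S" for z
    proof (rule field_differentiable_bound[OF S(4) _ L])
      fix w assume "w \<in> S"
      thus "(H has_field_derivative deriv H w) (at w within S)"
        using holomorphic_derivI[OF hol U] SU DERIV_subset by blast
    qed (use that S in auto)
    thus ?thesis using that unfolding K_def by blast
  qed
  define A where "A = T\<^sup>2 - c\<^sup>2"
  have A: "A > 0" using T \<kappa>2 by (simp add: A_def cT power_mult_distrib)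
  define N where "N = L * (c\<^sup>2 + T\<^sup>2) / (2 * pi * A)"
  define R where "R = (\<lambda>y. (2 * N * y + M' * exp (- (pi * \<delta> * T\<^sup>2 / y)) * sqrt (y / \<delta>)) / sqrt y)"
  have main: "norm (gauss_mean \<epsilon> a H y - H \<epsilon>) \<le> R y" if y: "y > 0" for y
  proof -
    define E where "E = (\<lambda>z. exp (of_real pi * (z - \<epsilon>)\<^sup>2 / of_real y))"
    define f where "f = (\<lambda>z. E z * K z)"
    \<comment> \<open>Base of the triangle: replaced by the two sides through the centre.\<close>
    have inner: "norm (integral {b - T..b + T} (\<lambda>t. f (Complex a t))) \<le> 2 * N * y"
    proof -
      have contf: "continuous_on S f"
        unfolding f_def E_def using y by (intro continuous_intros contK) auto
      have fU: "f holomorphic_on S"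
        unfolding f_def E_def using y by (intro holomorphic_intros holomorphic_on_subset[OF KU SU]) auto
      have ci: "f contour_integrable_on linepath x z" if "closed_segment x z \<subseteq> S" for x z
        by (rule contour_integrable_continuous_linepath[OF continuous_on_subset[OF contf that]])
      have "(f has_contour_integral 0) (linepath p \<epsilon> +++ linepath \<epsilon> q +++ linepath q p)"
        using fU unfolding S_def by (rule Cauchy_theorem_triangle)
      hence "contour_integral (linepath p \<epsilon>) f + (contour_integral (linepath \<epsilon> q) f + contour_integral (linepath q p) f) = 0"
        using ci segs by (auto dest!: contour_integral_unique)
      moreover have "contour_integral (linepath q p) f = - contour_integral (linepath p q) f"
        using contour_integral_reverse_linepath[OF continuous_on_subset[OF contf segs(4)]] by simp
      moreover have "contour_integral (linepath p \<epsilon>) f = - contour_integral (linepath \<epsilon> p) f"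
        using contour_integral_reverse_linepath[OF continuous_on_subset[OF contf segs(1)]] by simp
      ultimately have 1: "contour_integral (linepath p q) f
            = contour_integral (linepath \<epsilon> q) f - contour_integral (linepath \<epsilon> p) f"
        by (simp add: algebra_simps)
      have q: "norm (contour_integral (linepath \<epsilon> q) f) \<le> N * y"
      proof -
        have "(Im (q - \<epsilon>))\<^sup>2 - (Re (q - \<epsilon>))\<^sup>2 = A" "(norm (q - \<epsilon>))\<^sup>2 = c\<^sup>2 + T\<^sup>2"
          by (simp_all add: q_def b_def A_def c_def cmod_power2)
        thus ?thesis
          using norm_integral_steep_segment[of y q \<epsilon> K L] y A L segs contK
          by (simp add: f_def E_def N_def subset_iff continuous_on_subset)
      qed
      have p: "norm (contour_integral (linepath \<epsilon> p) f) \<le> N * y"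
      proof -
        have "(Im (p - \<epsilon>))\<^sup>2 - (Re (p - \<epsilon>))\<^sup>2 = A" "(norm (p - \<epsilon>))\<^sup>2 = c\<^sup>2 + T\<^sup>2"
          by (simp_all add: p_def b_def A_def c_def cmod_power2)
        thus ?thesis
          using norm_integral_steep_segment[of y p \<epsilon> K L] y A L segs contK
          by (simp add: f_def E_def N_def subset_iff continuous_on_subset)
      qed
      have "contour_integral (linepath p q) f = \<i> * integral {b - T..b + T} (\<lambda>t. f (Complex a t))"
        by (rule contour_integral_linepath_same_Re) (use T in \<open>auto simp: p_def q_def\<close>)
      hence "norm (integral {b - T..b + T} (\<lambda>t. f (Complex a t))) = norm (contour_integral (linepath p q) f)"
        by (simp add: norm_mult)
      also have "\<dots> \<le> norm (contour_integral (linepath \<epsilon> q) f) + norm (contour_integral (linepath \<epsilon> p) f)"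
        unfolding 1 by (rule norm_triangle_ineq4)
      finally show ?thesis using p q by simp
    qed
    have intE: "has_bochner_integral lborel (\<lambda>t. E (Complex a t)) (of_real (sqrt y))"
      unfolding E_def by (rule gaussian_line[OF y])
    have contL: "continuous_on UNIV (\<lambda>t. H (Complex a t))"
      by (rule continuous_on_compose2[OF holomorphic_on_imp_continuous_on[OF hol]])
         (use line in \<open>auto intro!: continuous_intros simp: Complex_eq\<close>)
    hence [measurable]: "(\<lambda>t. H (Complex a t)) \<in> borel_measurable borel"
      by (rule borel_measurable_continuous_onI)
    have [measurable]: "(\<lambda>t. E (Complex a t)) \<in> borel_measurable borel"
      using intE by (auto simp: has_bochner_integral_iff dest: borel_measurable_integrable)
    have M: "M \<ge> 0" using order_trans[OF norm_ge_zero bd] .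
    have intH: "integrable lborel (\<lambda>t. E (Complex a t) * H (Complex a t))"
    proof (rule Bochner_Integration.integrable_bound)
      show "integrable lborel (\<lambda>t. M * norm (E (Complex a t)))"
        using intE by (auto simp: has_bochner_integral_iff)
      show "AE t in lborel. norm (E (Complex a t) * H (Complex a t)) \<le> norm (M * norm (E (Complex a t)))"
        using bd M by (intro AE_I2) (simp add: norm_mult mult.commute[of M] mult_left_mono)
    qed measurable
    have feq: "f (Complex a t) = E (Complex a t) * H (Complex a t) - E (Complex a t) * H \<epsilon>" for t
      by (simp add: f_def K_def algebra_simps)
    have intf: "integrable lborel (\<lambda>t. f (Complex a t))"
      unfolding feq using intE by (intro Bochner_Integration.integrable_diff intH) (auto simp: has_bochner_integral_iff)
    have "(LINT t|lborel. f (Complex a t))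
        = (LINT t|lborel. E (Complex a t) * H (Complex a t)) - of_real (sqrt y) * H \<epsilon>"
      unfolding feq using intE intH by (subst Bochner_Integration.integral_diff) (auto simp: has_bochner_integral_iff)
    hence eq: "gauss_mean \<epsilon> a H y - H \<epsilon> = (LINT t|lborel. f (Complex a t)) / of_real (sqrt y)"
      using y by (simp add: gauss_mean_def E_def diff_divide_distrib)
    define g where "g = (\<lambda>t. (M' * exp (- (pi * \<delta> * T\<^sup>2 / y))) * exp (- (pi * (t - b)\<^sup>2 / (y / \<delta>))))"
    have intg: "has_bochner_integral lborel g (M' * exp (- (pi * \<delta> * T\<^sup>2 / y)) * sqrt (y / \<delta>))"
      unfolding g_def by (intro has_bochner_integral_mult_right gaussian_line_real) (use y \<delta> in auto)
    \<comment> \<open>Outside the cone \<open>c\<^sup>2 \<le> \<kappa>\<^sup>2 * s\<^sup>2\<close>, so the kernel decays although \<open>c\<close> is fixed.\<close>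
    have outer: "norm (indicator (- {b - T..b + T}) t *\<^sub>R f (Complex a t)) \<le> g t" for t
    proof (cases "t \<in> {b - T..b + T}")
      case True
      thus ?thesis using M by (simp add: g_def M'_def)
    next
      case False
      define s where "s = t - b"
      have "T \<le> \<bar>s\<bar>" using False by (auto simp: s_def)
      hence Ts: "T\<^sup>2 \<le> s\<^sup>2" using T by (metis abs_le_square_iff abs_of_pos)
      have "c\<^sup>2 - s\<^sup>2 \<le> \<kappa>\<^sup>2 * s\<^sup>2 - s\<^sup>2"
        using Ts by (simp add: cT power_mult_distrib mult_left_mono)
      also have "\<dots> = - (\<delta> * s\<^sup>2) - \<delta> * s\<^sup>2" by (simp add: \<delta>_def algebra_simps diff_divide_distrib)
      also have "\<dots> \<le> - (\<delta> * s\<^sup>2) - \<delta> * T\<^sup>2" using Ts \<delta> by simp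
      finally have 1: "pi * (c\<^sup>2 - s\<^sup>2) / y \<le> pi * (- (\<delta> * s\<^sup>2) - \<delta> * T\<^sup>2) / y"
        using y by (intro divide_right_mono mult_left_mono) auto
      have "norm (E (Complex a t)) = exp (pi * (c\<^sup>2 - s\<^sup>2) / y)"
        unfolding E_def norm_gauss_kernel by (simp add: c_def s_def b_def)
      also have "\<dots> \<le> exp (pi * (- (\<delta> * s\<^sup>2) - \<delta> * T\<^sup>2) / y)" using 1 by simp
      also have "\<dots> = exp (- (pi * \<delta> * T\<^sup>2 / y)) * exp (- (pi * s\<^sup>2 / (y / \<delta>)))"
        using y \<delta> unfolding exp_add [symmetric] by (simp add: field_simps)
      finally have 2: "norm (E (Complex a t)) \<le> exp (- (pi * \<delta> * T\<^sup>2 / y)) * exp (- (pi * s\<^sup>2 / (y / \<delta>)))" .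
      have 3: "norm (K (Complex a t)) \<le> M'"
        unfolding K_def M'_def using bd[of t] norm_triangle_ineq4[of "H (Complex a t)" "H \<epsilon>"] by linarith
      have "norm (f (Complex a t)) \<le> exp (- (pi * \<delta> * T\<^sup>2 / y)) * exp (- (pi * s\<^sup>2 / (y / \<delta>))) * M'"
        unfolding f_def norm_mult by (intro mult_mono 2 3) auto
      thus ?thesis using False by (simp add: g_def s_def mult_ac)
    qed
    have setint: "set_integrable lborel {b - T..b + T} (\<lambda>t. f (Complex a t))"
         "set_integrable lborel (- {b - T..b + T}) (\<lambda>t. f (Complex a t))"
      unfolding set_integrable_def by (intro integrable_mult_indicator intf; simp)+
    have split: "(LINT t|lborel. f (Complex a t)) = (LINT t:{b - T..b + T}|lborel. f (Complex a t))
        + (LINT t:(- {b - T..b + T})|lborel. f (Complex a t))"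
    proof -
      have "(LINT t|lborel. f (Complex a t)) = (LINT t|lborel. indicator {b - T..b + T} t *\<^sub>R f (Complex a t)
              + indicator (- {b - T..b + T}) t *\<^sub>R f (Complex a t))"
        by (intro Bochner_Integration.integral_cong) (auto simp: indicator_def)
      also have "\<dots> = (LINT t:{b - T..b + T}|lborel. f (Complex a t))
          + (LINT t:(- {b - T..b + T})|lborel. f (Complex a t))"
        using setint unfolding set_lebesgue_integral_def set_integrable_def
        by (rule Bochner_Integration.integral_add)
      finally show ?thesis .
    qed
    have "norm (LINT t:(- {b - T..b + T})|lborel. f (Complex a t)) \<le> (LINT t|lborel. g t)"
      unfolding set_lebesgue_integral_def
      using setint(2) intg outer unfolding set_integrable_def
      by (intro Bochner_Integration.integral_norm_bound_integral) (auto simp: has_bochner_integral_iff)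
    also have "\<dots> = M' * exp (- (pi * \<delta> * T\<^sup>2 / y)) * sqrt (y / \<delta>)"
      using intg by (simp add: has_bochner_integral_iff)
    finally have "norm (LINT t|lborel. f (Complex a t)) \<le> 2 * N * y + M' * exp (- (pi * \<delta> * T\<^sup>2 / y)) * sqrt (y / \<delta>)"
      unfolding split set_borel_integral_eq_integral(2)[OF setint(1)] using inner
      by (intro norm_triangle_le) linarith
    thus ?thesis unfolding eq R_def norm_divide using y by (simp add: divide_right_mono)
  qed
  have "(R \<longlongrightarrow> 0) (at_right 0)"
  proof -
    define k where "k = pi * \<delta> * T\<^sup>2"
    have k: "k > 0" using \<delta> T by (simp add: k_def)
    have "((\<lambda>y. (2 * N * y + M' * exp (- (k / y)) * sqrt (y / \<delta>)) / sqrt y) \<longlongrightarrow> 0) (at_right 0)"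
      using k \<delta> by real_asymp
    thus ?thesis by (simp add: R_def k_def)
  qed
  hence "((\<lambda>y. gauss_mean \<epsilon> a H y - H \<epsilon>) \<longlongrightarrow> 0) (at_right 0)"
    by (rule Lim_null_comparison [rotated]) (auto intro!: main eventually_at_right_less eventually_mono[OF eventually_at_right_less])
  thus ?thesis by (simp add: LIM_zero_iff)
qed

section \<open>Symmetric q-numbers\<close>

text \<open>
  The symmetric q-number \<open>(v ^ r - v ^ (- r)) / (v - v ^ (- 1))\<close> for \<open>r \<ge> 0\<close>, written as a finite sum so that it has no
  singularity at \<open>v = 1\<close> and \<open>v = - 1\<close>.
\<close>

definition q_number :: "complex \<Rightarrow> int \<Rightarrow> complex" where
  "q_number v r = (\<Sum>j\<in>{0..r - 1}. v powi (1 - r + 2 * j))"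

lemma sum_int_atLeastAtMost_nat: "(\<Sum>j\<in>{0..r - 1}. f j) = (\<Sum>j<nat r. f (int j))" for r :: int
  by (rule sum.reindex_bij_witness[of _ int nat]) auto

lemma q_number_mult:
  assumes "v \<noteq> 0" "r \<ge> 0"
  shows "(v - inverse v) * q_number v r = v powi r - v powi (- r)"
proof -
  have "(v - inverse v) * q_number v r = (\<Sum>j<nat r. v powi (2 * int (Suc j) - r) - v powi (2 * int j - r))"
    unfolding q_number_def sum_int_atLeastAtMost_nat sum_distrib_left
  proof (rule sum.cong)
    fix j
    have "v * v powi (1 - r + 2 * int j) = v powi (2 * int (Suc j) - r)"
      using assms by (subst power_int_add_1' [symmetric]) (auto simp: algebra_simps)
    moreover have "inverse v * v powi (1 - r + 2 * int j) = v powi (2 * int j - r)"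
    proof -
      have "v powi (1 - r + 2 * int j) = v * v powi (2 * int j - r)"
        using assms by (subst power_int_add_1' [symmetric]) (auto simp: algebra_simps)
      thus ?thesis using assms by simp
    qed
    ultimately show "(v - inverse v) * v powi (1 - r + 2 * int j) = v powi (2 * int (Suc j) - r) - v powi (2 * int j - r)"
      by (simp add: left_diff_distrib)
  qed auto
  also have "\<dots> = v powi r - v powi (- r)"
    using assms by (subst sum_lessThan_telescope) simp
  finally show ?thesis .
qed

lemma q_number_reverse: "q_number v r = (\<Sum>j\<in>{0..r - 1}. v powi (r - 1 - 2 * j))"
  unfolding q_number_def by (rule sum.reindex_bij_witness[of _ "\<lambda>j. r - 1 - j" "\<lambda>j. r - 1 - j"])
     (auto simp: algebra_simps)

text \<open>
  The zeros are the \<open>2 * r\<close>-th roots of unity other than \<open>1\<close> and \<open>- 1\<close>. The second fact is what distinguishes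
  true poles of the limiting characters from removable ones.
\<close>

lemma q_number_root_of_unity_order:
  assumes "v \<noteq> 0" "r > 0" "q_number v r = 0"
  shows "v powi (2 * r) = 1" "v powi 2 \<noteq> 1"
proof -
  have "v powi r = v powi (- r)" using q_number_mult[of v r] assms by simp
  moreover have "v powi (2 * r) = v powi r * v powi r" using assms by (simp flip: power_int_add)
  moreover have "v powi r * v powi (- r) = 1" using assms by (simp add: power_int_minus)
  ultimately show "v powi (2 * r) = 1" by simp
  show "v powi 2 \<noteq> 1"
  proof
    assume 1: "v powi 2 = 1"
    have "v powi (1 - r + 2 * j) = v powi (1 - r)" for j
      using assms 1 by (simp add: power_int_add power_int_mult)
    hence "q_number v r = of_int r * v powi (1 - r)" using assms by (simp add: q_number_def)
    thus False using assms by simp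
  qed
qed

lemma q_number_1 [simp]: "q_number v 1 = 1"
  by (simp add: q_number_def)

text \<open>
  Tensoring with the two-dimensional representation: both fusion rules for the generators of the form
  \<open>I(2, 1; 0)\<close> and \<open>I(1, 2; 0)\<close> come from here.
\<close>

lemma q_number_2_mult:
  assumes "v \<noteq> 0" "v - inverse v \<noteq> 0" "r \<ge> 1"
  shows "q_number v 2 * q_number v r = q_number v (r - 1) + q_number v (r + 1)"
proof -
  have pw: "v powi (r + 1) = v powi r * v" "v powi (r - 1) = v powi r / v"
     "v powi (- (r + 1)) = inverse (v powi r) / v" "v powi (- (r - 1)) = inverse (v powi r) * v"
    using assms by (simp_all add: power_int_add power_int_diff power_int_minus field_simps)
  have 2: "(v - inverse v) * q_number v 2 = v\<^sup>2 - inverse v ^ 2"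
    using q_number_mult[of v 2] assms by (simp add: power_int_minus power_inverse)
  have "(v - inverse v) ^ 2 * (q_number v 2 * q_number v r) = ((v - inverse v) * q_number v 2) * ((v - inverse v) * q_number v r)"
    by (simp add: power2_eq_square mult_ac)
  also have "\<dots> = (v\<^sup>2 - inverse v ^ 2) * (v powi r - inverse (v powi r))"
    unfolding 2 using assms by (subst q_number_mult) (simp_all add: power_int_minus)
  also have "\<dots> = (v - inverse v) * (((v powi (r - 1) - v powi (- (r - 1)))) + (v powi (r + 1) - v powi (- (r + 1))))"
    unfolding pw using assms by (simp add: field_simps power2_eq_square)
  also have "\<dots> = (v - inverse v) ^ 2 * (q_number v (r - 1) + q_number v (r + 1))"
    using assms q_number_mult[of v "r - 1"] q_number_mult[of v "r + 1"] by (simp add: power2_eq_square mult.assoc distrib_left)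
  finally show ?thesis using assms by simp
qed

text \<open>
  At the border \<open>r = p\<close> the term with index \<open>p + 1\<close> has no module of its own. It splits into a second copy
  of \<open>p - 1\<close> and the powers \<open>v ^ p\<close> and \<open>v ^ (- p)\<close>. For \<open>p = pp\<close> these are \<open>u ^ P\<close> and \<open>u ^ (- P)\<close>,
  that is, shifts of the label \<open>n\<close> by one.
\<close>

lemma q_number_top:
  assumes "v \<noteq> 0" "v - inverse v \<noteq> 0" "p \<ge> 1"
  shows "q_number v (p + 1) = v powi p + inverse (v powi p) + q_number v (p - 1)"
proof -
  have pw: "v powi (p + 1) = v powi p * v" "v powi (p - 1) = v powi p / v"
     "v powi (- (p + 1)) = inverse (v powi p) / v" "v powi (- (p - 1)) = inverse (v powi p) * v"
    using assms by (simp_all add: power_int_add power_int_diff power_int_minus field_simps)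
  have "(v - inverse v) * q_number v (p + 1) = v powi (p + 1) - v powi (- (p + 1))"
    using assms by (intro q_number_mult) auto
  also have "\<dots> = (v - inverse v) * (v powi p + inverse (v powi p)) + (v powi (p - 1) - v powi (- (p - 1)))"
    unfolding pw using assms by (simp add: field_simps)
  also have "\<dots> = (v - inverse v) * (v powi p + inverse (v powi p) + q_number v (p - 1))"
    using assms q_number_mult[of v "p - 1"] by (simp add: distrib_left)
  finally show ?thesis using assms by simp
qed

lemma holomorphic_on_q_number [holomorphic_intros]:
  assumes "f holomorphic_on A" "\<And>z. z \<in> A \<Longrightarrow> f z \<noteq> 0"
  shows "(\<lambda>z. q_number (f z) r) holomorphic_on A"
  unfolding q_number_def using assms by (intro holomorphic_intros) auto

section \<open>Summation by parts and the eta function\<close>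

text \<open>
  This turns the weight \<open>k + 1\<close> of the interior characters into the constant weight of the border characters
  and of theta functions.
\<close>

lemma sums_by_parts:
  fixes f :: "nat \<Rightarrow> complex"
  assumes "summable f" "summable (\<lambda>k. of_nat (k + 1) * f k)"
  shows "(\<lambda>k. of_nat (k + 1) * (f k - f (k + 1))) sums suminf f"
proof -
  define G where "G = (\<Sum>k. of_nat k * f k)"
  have "summable (\<lambda>k. of_nat (k + 1) * f k - f k)"
    by (rule summable_diff[OF assms(2,1)])
  hence G: "(\<lambda>k. of_nat k * f k) sums G"
    unfolding G_def by (simp add: algebra_simps summable_sums)
  from sums_Suc_iff[of "\<lambda>k. of_nat k * f k" G] G
  have "(\<lambda>k. of_nat (k + 1) * f (k + 1)) sums G" by simp
  moreover have "(\<lambda>k. of_nat k * f k + f k) sums (G + suminf f)"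
    by (intro sums_add G summable_sums assms)
  ultimately have "(\<lambda>k. (of_nat k * f k + f k) - of_nat (k + 1) * f (k + 1)) sums (G + suminf f - G)"
    by (rule sums_diff[rotated])
  thus ?thesis by (simp add: algebra_simps)
qed

text \<open>
  The eta function divides every character and has to cancel in the quotients.
\<close>

lemma dedekind_eta_nonzero:
  assumes "y > 0"
  shows "dedekind_eta (\<i> * of_real y) \<noteq> 0"
proof -
  define q where "q = exp (- (2 * pi * y))"
  have q: "0 < q" "q < 1" using assms by (simp_all add: q_def)
  have eq: "qpow (\<i> * of_real y) (of_nat (n + 1)) = of_real (q ^ (n + 1))" for n
  proof -
    have "complex_of_real (q ^ (n + 1)) = of_real (exp (of_nat (n + 1) * - (2 * pi * y)))"
      unfolding q_def by (subst exp_of_nat_mult) simp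
    also have "\<dots> = exp (of_real (of_nat (n + 1) * - (2 * pi * y)))" by (rule exp_of_real [symmetric])
    also have "\<dots> = qpow (\<i> * of_real y) (of_nat (n + 1))"
      unfolding qpow_def by (intro arg_cong[of _ _ exp]) (simp add: algebra_simps)
    finally show ?thesis ..
  qed
  have qn: "q ^ (n + 1) < 1" for n
    using q by (simp only: Suc_eq_plus1 [symmetric] power_Suc_less_one)
  have ne1: "- complex_of_real (q ^ (n + 1)) \<noteq> -1" for n
  proof -
    have "complex_of_real (q ^ (n + 1)) \<noteq> 1"
      unfolding of_real_eq_1_iff using qn[of n] by linarith
    thus ?thesis unfolding neg_equal_iff_equal .
  qed
  have ne: "1 + (- complex_of_real (q ^ (n + 1))) \<noteq> 0" for n
    using ne1[of n] minus_unique[of 1 "- complex_of_real (q ^ (n + 1))"] by fastforce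
  have "summable (\<lambda>n. q * q ^ n)" using q by (intro summable_mult summable_geometric) auto
  hence "summable (\<lambda>n. norm (- complex_of_real (q ^ (n + 1))))"
    using q by (simp add: norm_mult norm_power)
  hence "convergent_prod (\<lambda>n. 1 + (- complex_of_real (q ^ (n + 1))))"
    by (intro summable_imp_convergent_prod_complex ne1)
  from prodinf_nonzero[OF this ne] have "prodinf (\<lambda>n. 1 - complex_of_real (q ^ (n + 1))) \<noteq> 0"
    by (simp only: diff_conv_add_uminus not_False_eq_True)
  thus ?thesis
    unfolding dedekind_eta_def eq by (simp add: qpow_def del: power_Suc)
qed

section \<open>Fock labels as lattice points\<close>

locale singlet =
  fixes pp pm :: int
  assumes pp: "pp \<ge> 2" and pm: "pm \<ge> 2"
begin

abbreviation "\<alpha> \<equiv> alpha_full pp pm"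

text \<open>
  All exponents in question are integral powers of this quantity, called \<open>u\<close> in the overview.
\<close>

definition fugacity :: "complex \<Rightarrow> complex" where
  "fugacity z = exp (2 * of_real pi * z / of_real \<alpha>)"

text \<open>
  Up to the factor \<open>\<eta>\<close>, the character at \<open>\<tau> = i * y\<close> of the Fock module of weight \<open>alpha_zero / 2 + N / \<alpha>\<close>; at \<open>z = 0\<close>,
  a summand of a theta function.
\<close>

definition lattice_term :: "complex \<Rightarrow> real \<Rightarrow> int \<Rightarrow> complex" where
  "lattice_term z y N = gauss_term z y (of_int N / \<alpha>)"

text \<open>
  The function \<open>H\<close> of the overview. The q-numbers in the denominator are used in place of
  \<open>(u ^ P - u ^ (- P))\<^sup>2\<close>, so that the formula is holomorphic at the points \<open>i * m / \<alpha>\<close> with \<open>P\<close> dividing \<open>m\<close> without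
  further argument.
\<close>

definition irr_limit :: "int \<Rightarrow> int \<Rightarrow> int \<Rightarrow> complex \<Rightarrow> complex" where
  "irr_limit r s n z = fugacity z powi (n * (pp * pm)) * q_number (fugacity z powi pm) r * q_number (fugacity z powi pp) s
     / (q_number (fugacity z powi pm) pp * q_number (fugacity z powi pp) pm)"

text \<open>
  The summands of the interior character, with the four Fock labels replaced by their lattice points. The labels
  \<open>r = pp\<close> and \<open>s = pm\<close> are meaningful here and will serve for the border cases.
\<close>

definition irr_term :: "complex \<Rightarrow> real \<Rightarrow> int \<Rightarrow> int \<Rightarrow> int \<Rightarrow> nat \<Rightarrow> complex" where
  "irr_term z y r s n k = of_nat (k + 1) *
     (lattice_term z y ((n - 2 * int k - 2) * (pp * pm) + (r * pm + s * pp))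
      + lattice_term z y ((n - 2 * int k - 2) * (pp * pm) - (r * pm + s * pp))
      - lattice_term z y ((n - 2 * int k - 2) * (pp * pm) - (r * pm - s * pp))
      - lattice_term z y ((n - 2 * int k - 2) * (pp * pm) + (r * pm - s * pp)))"

lemma P_pos: "pp * pm > 0" using pp pm by simp

lemma alpha_pos: "\<alpha> > 0" using pp pm by (simp add: alpha_full_def)

lemma alpha_sq: "\<alpha>\<^sup>2 = 2 * of_int (pp * pm)" using pp pm by (simp add: alpha_full_def)

lemma alpha_plus_eq: "alpha_plus pp pm = 2 * of_int pm / \<alpha>"
proof -
  have "alpha_plus pp pm = \<alpha> / of_int pp"
  proof (rule power2_eq_imp_eq)
    show "(alpha_plus pp pm)\<^sup>2 = (\<alpha> / of_int pp)\<^sup>2"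
      unfolding power_divide alpha_sq using pp pm by (simp add: alpha_plus_def power2_eq_square)
  qed (use pp pm alpha_pos in \<open>auto simp: alpha_plus_def\<close>)
  also have "\<dots> = 2 * of_int pm / \<alpha>"
    using pp alpha_pos alpha_sq by (simp add: field_simps power2_eq_square)
  finally show ?thesis .
qed

lemma alpha_minus_eq: "alpha_minus pp pm = - (2 * of_int pp / \<alpha>)"
proof -
  have "- alpha_minus pp pm = \<alpha> / of_int pm"
  proof (rule power2_eq_imp_eq)
    show "(- alpha_minus pp pm)\<^sup>2 = (\<alpha> / of_int pm)\<^sup>2"
      unfolding power_divide alpha_sq using pp pm by (simp add: alpha_minus_def power2_eq_square)
  qed (use pp pm alpha_pos in \<open>auto simp: alpha_minus_def\<close>)
  also have "\<dots> = 2 * of_int pp / \<alpha>"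
    using pm alpha_pos alpha_sq by (simp add: field_simps power2_eq_square)
  finally show ?thesis by simp
qed

lemma alpha_rsn_eq:
  "alpha_rsn pp pm r s n - alpha_zero pp pm / 2 = of_int (n * (pp * pm) - r * pm + s * pp) / \<alpha>"
proof -
  have "\<alpha> = 2 * of_int (pp * pm) / \<alpha>" using alpha_pos alpha_sq by (simp add: field_simps power2_eq_square)
  hence "alpha_rsn pp pm r s n - alpha_zero pp pm / 2
    = (1 - real_of_int r) / 2 * (2 * of_int pm / \<alpha>) + (1 - real_of_int s) / 2 * - (2 * of_int pp / \<alpha>)
      + real_of_int n / 2 * (2 * of_int (pp * pm) / \<alpha>) - (2 * of_int pm / \<alpha> + - (2 * of_int pp / \<alpha>)) / 2"
    unfolding alpha_rsn_def alpha_zero_def alpha_plus_eq alpha_minus_eq by simp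
  also have "\<dots> = of_int (n * (pp * pm) - r * pm + s * pp) / \<alpha>"
    using alpha_pos by (simp add: field_simps)
  finally show ?thesis .
qed

lemma fugacity_nonzero [simp]: "fugacity z \<noteq> 0" by (simp add: fugacity_def)

lemma norm_fugacity: "norm (fugacity z) = exp (2 * pi * Re z / \<alpha>)"
  by (simp add: fugacity_def)

lemma exp_eq_fugacity: "exp (2 * of_real pi * z * of_real (of_int N / \<alpha>)) = fugacity z powi N"
  by (simp add: fugacity_def exp_power_int mult_ac)

lemma ch_Fock_eq:
  assumes "y > 0"
  shows "dedekind_eta (\<i> * of_real y) * ch_Fock pp pm \<epsilon> l (\<i> * of_real y) =
     exp (2 * of_real pi * \<epsilon> * (l - of_real (alpha_zero pp pm) / 2)
          - of_real (pi * y) * (l - of_real (alpha_zero pp pm) / 2)\<^sup>2)"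
  using dedekind_eta_nonzero[OF assms]
  by (simp add: ch_Fock_def qpow_def mult_exp_exp algebra_simps)

lemma ch_Fock_rsn_eq:
  assumes "y > 0"
  shows "dedekind_eta (\<i> * of_real y) * ch_Fock_rsn pp pm \<epsilon> r s n (\<i> * of_real y) =
     lattice_term \<epsilon> y (n * (pp * pm) - r * pm + s * pp)"
proof -
  have "complex_of_real (alpha_rsn pp pm r s n) - of_real (alpha_zero pp pm) / 2 =
     of_real (of_int (n * (pp * pm) - r * pm + s * pp) / \<alpha>)"
    unfolding alpha_rsn_eq [symmetric] by simp
  thus ?thesis
    unfolding ch_Fock_rsn_def ch_Fock_eq[OF assms] lattice_term_def gauss_term_def
    by (simp only: of_real_mult of_real_power)
qed

lemma summable_geometric_exp:
  assumes "a > 0"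
  shows "summable (\<lambda>k. real (k + 1) * exp (2 * pi * a * (of_int (M - 2 * int k * (pp * pm)) / \<alpha>)))"
    and "summable (\<lambda>k. exp (2 * pi * a * (of_int (M - 2 * int k * (pp * pm)) / \<alpha>)))"
proof -
  define x where "x = exp (- (2 * pi * a * (2 * of_int (pp * pm) / \<alpha>)))"
  have x: "norm x < 1" using assms P_pos alpha_pos by (auto simp: x_def simp del: of_int_mult)
  have eq: "exp (2 * pi * a * (of_int (M - 2 * int k * (pp * pm)) / \<alpha>))
     = exp (2 * pi * a * (of_int M / \<alpha>)) * x ^ k" for k
    using alpha_pos unfolding x_def exp_of_nat_mult [symmetric] mult_exp_exp by (simp add: field_simps)
  show "summable (\<lambda>k. exp (2 * pi * a * (of_int (M - 2 * int k * (pp * pm)) / \<alpha>)))"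
    unfolding eq using x by (intro summable_mult summable_geometric)
  have "summable (\<lambda>k. exp (2 * pi * a * (of_int M / \<alpha>)) * (of_nat (Suc k) * x ^ k))"
    using x by (intro summable_mult sums_summable[OF geometric_deriv_sums])
  thus "summable (\<lambda>k. real (k + 1) * exp (2 * pi * a * (of_int (M - 2 * int k * (pp * pm)) / \<alpha>)))"
    unfolding eq by (simp add: mult_ac)
qed

text \<open>
  Gaussian damping gives convergence for every \<open>\<epsilon>\<close>. It is read off from the mean over the line \<open>Re z = 1\<close>, on
  which the undamped series converges geometrically.
\<close>

lemma summable_lattice_term:
  assumes "y > 0"
  shows "summable (\<lambda>k. of_nat (k + 1) * lattice_term \<epsilon> y (M - 2 * int k * (pp * pm)))"
    and "summable (\<lambda>k. lattice_term \<epsilon> y (M - 2 * int k * (pp * pm)))"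
proof -
  show "summable (\<lambda>k. of_nat (k + 1) * lattice_term \<epsilon> y (M - 2 * int k * (pp * pm)))"
    unfolding lattice_term_def
    by (rule sums_summable, rule gauss_transform_series(2)[OF assms, where a = 1 and h = "\<lambda>z. \<Sum>k. of_nat (k + 1) * exp (2 * of_real pi * z * of_real (of_int (M - 2 * int k * (pp * pm)) / \<alpha>))"])
       (use summable_geometric_exp(1)[of 1] in \<open>simp_all del: of_int_diff of_int_mult of_nat_add of_nat_Suc\<close>)
  have "summable (\<lambda>k. 1 * lattice_term \<epsilon> y (M - 2 * int k * (pp * pm)))"
    unfolding lattice_term_def
    by (rule sums_summable, rule gauss_transform_series(2)[OF assms, where a = 1 and h = "\<lambda>z. \<Sum>k. 1 * exp (2 * of_real pi * z * of_real (of_int (M - 2 * int k * (pp * pm)) / \<alpha>))"])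
       (use summable_geometric_exp(2)[of 1] in \<open>simp_all del: of_int_diff of_int_mult\<close>)
  thus "summable (\<lambda>k. lattice_term \<epsilon> y (M - 2 * int k * (pp * pm)))" by simp
qed

lemma norm_fugacity_powi: "norm (fugacity z powi N) = exp (2 * pi * Re z * (of_int N / \<alpha>))"
  by (simp add: norm_power_int norm_fugacity exp_power_int mult_ac)

lemma norm_fugacity_powi_less_1:
  assumes "Re z > 0" shows "norm (fugacity z powi (- (2 * (pp * pm)))) < 1"
proof -
  have "2 * pi * Re z * (of_int (- (2 * (pp * pm))) / \<alpha>) < 0"
    using assms alpha_pos P_pos by (intro mult_pos_neg divide_neg_pos) (auto simp del: of_int_mult)
  thus ?thesis by (simp add: norm_fugacity_powi)
qed

section \<open>Interior characters as Gaussian means\<close>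

text \<open>
  The undamped series over one of the four half lattices, in closed form. Separately these have double poles at
  all points \<open>i * m / \<alpha>\<close>; only their combination \<open>irr_limit\<close> is better behaved.
\<close>

definition half_lattice_sum :: "int \<Rightarrow> complex \<Rightarrow> complex" where
  "half_lattice_sum M z = fugacity z powi M / (1 - fugacity z powi (- (2 * (pp * pm))))\<^sup>2"

lemma half_lattice_sums:
  assumes "Re z > 0"
  shows "(\<lambda>k. of_nat (k + 1) * exp (2 * of_real pi * z * of_real (of_int (M - 2 * int k * (pp * pm)) / \<alpha>)))
     sums half_lattice_sum M z"
proof -
  define x where "x = fugacity z powi (- (2 * (pp * pm)))"
  have eq: "exp (2 * of_real pi * z * of_real (of_int (M - 2 * int k * (pp * pm)) / \<alpha>)) = fugacity z powi M * x ^ k" for k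
  proof -
    have "fugacity z powi (M - 2 * int k * (pp * pm)) = fugacity z powi (M + (- (2 * (pp * pm))) * int k)"
      by (simp add: algebra_simps)
    also have "\<dots> = fugacity z powi M * x ^ k"
      unfolding x_def by (simp only: power_int_add[OF disjI1[OF fugacity_nonzero]] power_int_mult power_int_of_nat)
    finally show ?thesis unfolding exp_eq_fugacity .
  qed
  have "norm x < 1" unfolding x_def by (rule norm_fugacity_powi_less_1[OF assms])
  from sums_mult[OF geometric_deriv_sums[OF this], of "fugacity z powi M"]
  show ?thesis unfolding eq half_lattice_sum_def by (simp add: x_def mult_ac)
qed

lemma lattice_term_sums_gauss_mean:
  assumes y: "y > 0" and a: "a > 0"
  shows "integrable lborel (\<lambda>t. exp (of_real pi * (Complex a t - \<epsilon>)\<^sup>2 / of_real y) * half_lattice_sum M (Complex a t))"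
    and "(\<lambda>k. of_nat (k + 1) * lattice_term \<epsilon> y (M - 2 * int k * (pp * pm))) sums gauss_mean \<epsilon> a (half_lattice_sum M) y"
proof -
  have h: "half_lattice_sum M (Complex a t) = (\<Sum>k. of_nat (k + 1) *
       exp (2 * of_real pi * Complex a t * of_real (of_int (M - 2 * int k * (pp * pm)) / \<alpha>)))" for t
    using half_lattice_sums[of "Complex a t" M] a by (intro sums_unique) auto
  have sm: "summable (\<lambda>k. norm (of_nat (k + 1) :: complex) * exp (2 * pi * a * (of_int (M - 2 * int k * (pp * pm)) / \<alpha>)))"
    using summable_geometric_exp(1)[OF a, of M] by (simp only: norm_of_nat)
  note * = gauss_transform_series[OF y sm h]
  show "integrable lborel (\<lambda>t. exp (of_real pi * (Complex a t - \<epsilon>)\<^sup>2 / of_real y) * half_lattice_sum M (Complex a t))"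
    by (rule *(1))
  show "(\<lambda>k. of_nat (k + 1) * lattice_term \<epsilon> y (M - 2 * int k * (pp * pm))) sums gauss_mean \<epsilon> a (half_lattice_sum M) y"
    unfolding lattice_term_def by (rule *(2))
qed

lemma norm_half_lattice_sum_le:
  assumes "a > 0"
  shows "norm (half_lattice_sum M (Complex a t)) \<le>
    exp (2 * pi * a * (of_int M / \<alpha>)) / (1 - exp (2 * pi * a * (of_int (- (2 * (pp * pm))) / \<alpha>)))\<^sup>2"
proof -
  define x where "x = fugacity (Complex a t) powi (- (2 * (pp * pm)))"
  have x: "norm x = exp (2 * pi * a * (of_int (- (2 * (pp * pm))) / \<alpha>))" unfolding x_def norm_fugacity_powi by simp
  have x1: "norm x < 1" unfolding x_def using assms by (intro norm_fugacity_powi_less_1) auto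
  have "1 - norm x \<le> norm (1 - x)" using norm_triangle_ineq2[of 1 x] by simp
  hence "(1 - norm x)\<^sup>2 \<le> (norm (1 - x))\<^sup>2" using x1 by (intro power_mono) auto
  thus ?thesis using x1
    unfolding half_lattice_sum_def norm_divide norm_power norm_fugacity_powi x_def[symmetric] x[symmetric]
    by (intro frac_le) auto
qed

lemma fugacity_powi_neq_1:
  assumes "Re z \<noteq> 0" "k \<noteq> 0" shows "fugacity z powi k \<noteq> 1"
proof
  assume "fugacity z powi k = 1"
  hence "exp (2 * pi * Re z * (of_int k / \<alpha>)) = 1" using norm_fugacity_powi[of z k] by simp
  thus False using assms alpha_pos by simp
qed

lemma q_number_frac:
  assumes "Re z \<noteq> 0" "d > 0" "r \<ge> 0"
  shows "q_number (fugacity z powi d) r = (fugacity z powi (d * r) - fugacity z powi (- (d * r))) / (fugacity z powi d - fugacity z powi (- d))"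
    and "fugacity z powi d - fugacity z powi (- d) \<noteq> 0"
proof -
  have "fugacity z powi d = fugacity z powi (2 * d) * fugacity z powi (- d)" by (simp flip: power_int_add)
  thus ne: "fugacity z powi d - fugacity z powi (- d) \<noteq> 0" using fugacity_powi_neq_1[of z "2 * d"] assms
    by auto
  have "(fugacity z powi d - inverse (fugacity z powi d)) * q_number (fugacity z powi d) r = (fugacity z powi d) powi r - (fugacity z powi d) powi (- r)"
    using assms by (intro q_number_mult) auto
  hence "(fugacity z powi d - fugacity z powi (- d)) * q_number (fugacity z powi d) r = fugacity z powi (d * r) - fugacity z powi (- (d * r))"
    by (simp add: power_int_minus flip: power_int_mult)
  thus "q_number (fugacity z powi d) r = (fugacity z powi (d * r) - fugacity z powi (- (d * r))) / (fugacity z powi d - fugacity z powi (- d))"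
    using ne by (simp add: field_simps)
qed

text \<open>
  The four signed half lattices assemble to the product \<open>(A - A ^ (- 1)) * (B - B ^ (- 1))\<close> with
  \<open>A = u ^ (r * pm)\<close> and \<open>B = u ^ (s * pp)\<close>, and the factors \<open>v - v ^ (- 1)\<close>, \<open>w - w ^ (- 1)\<close> cancel between
  numerator and denominator.
\<close>

lemma irr_limit_eq_half_lattice_sum:
  assumes "Re z \<noteq> 0" "r \<ge> 0" "s \<ge> 0"
  shows "irr_limit r s n z = half_lattice_sum ((n - 2) * (pp * pm) + (r * pm + s * pp)) z
      + half_lattice_sum ((n - 2) * (pp * pm) - (r * pm + s * pp)) z
      - half_lattice_sum ((n - 2) * (pp * pm) - (r * pm - s * pp)) z
      - half_lattice_sum ((n - 2) * (pp * pm) + (r * pm - s * pp)) z"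
proof -
  define u where "u = fugacity z"
  define P where "P = pp * pm"
  define A B where "A = u powi (r * pm)" "B = u powi (s * pp)"
  define Q where "Q = u powi P"
  have u: "u \<noteq> 0" by (simp add: u_def)
  have ABQ: "A \<noteq> 0" "B \<noteq> 0" "Q \<noteq> 0" using u by (simp_all add: A_B_def Q_def)
  have ne: "u powi P - u powi (- P) \<noteq> 0" using q_number_frac(2)[of z P] assms P_pos by (simp add: u_def P_def)
  have Q2: "Q\<^sup>2 \<noteq> 1"
    using ne ABQ by (auto simp: Q_def[symmetric] power_int_minus field_simps power2_eq_square)
  have "irr_limit r s n z = u powi (n * P) * (u powi (pm * r) - u powi (- (pm * r))) * (u powi (pp * s) - u powi (- (pp * s)))
      / ((u powi (pm * pp) - u powi (- (pm * pp))) * (u powi (pp * pm) - u powi (- (pp * pm))))"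
    unfolding irr_limit_def using assms pp pm q_number_frac[of z pp] q_number_frac[of z pm]
    by (simp add: u_def P_def)
  also have "\<dots> = Q powi n * (A - inverse A) * (B - inverse B) / (Q - inverse Q)\<^sup>2"
    using u by (simp add: A_B_def Q_def P_def power_int_minus power2_eq_square mult.commute[of n] mult.commute[of pm] mult.commute[of pp s] power_int_mult)
  also have "\<dots> = Q powi n * inverse Q ^ 2 * (A - inverse A) * (B - inverse B) / (1 - inverse Q ^ 2)\<^sup>2"
  proof -
    define D where "D = (1 - inverse Q ^ 2)\<^sup>2"
    have "(Q - inverse Q)\<^sup>2 = Q\<^sup>2 * D"
      using ABQ by (simp add: D_def field_simps power2_eq_square)
    thus ?thesis
      unfolding D_def [symmetric] by (simp add: divide_inverse power_inverse mult_ac)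
  qed
  finally have 1: "irr_limit r s n z = Q powi n * inverse Q ^ 2 * (A - inverse A) * (B - inverse B) / (1 - inverse Q ^ 2)\<^sup>2" .
  have 2: "u powi ((n - 2) * P) = Q powi n * inverse Q ^ 2"
    using ABQ by (simp add: Q_def mult.commute[of _ P] power_int_mult power_int_diff power_inverse divide_inverse)
  have 3: "u powi (- (2 * P)) = inverse Q ^ 2"
    using u by (simp add: Q_def power_int_minus mult.commute[of 2] power_int_mult power_inverse)
  have 4: "u powi ((n - 2) * P + (r * pm + s * pp)) = Q powi n * inverse Q ^ 2 * (A * B)"
      "u powi ((n - 2) * P - (r * pm + s * pp)) = Q powi n * inverse Q ^ 2 * (inverse A * inverse B)"
      "u powi ((n - 2) * P - (r * pm - s * pp)) = Q powi n * inverse Q ^ 2 * (inverse A * B)"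
      "u powi ((n - 2) * P + (r * pm - s * pp)) = Q powi n * inverse Q ^ 2 * (A * inverse B)"
    using u by (simp_all add: power_int_add power_int_diff 2 A_B_def divide_inverse)
  show ?thesis
    unfolding half_lattice_sum_def u_def[symmetric] P_def[symmetric] 3 4 1
    by (simp add: algebra_simps flip: add_divide_distrib diff_divide_distrib)
qed

lemma irr_term_sums_gauss_mean:
  assumes y: "y > 0" and a: "a > 0" and r: "r \<ge> 0" "s \<ge> 0"
  shows "irr_term \<epsilon> y r s n sums gauss_mean \<epsilon> a (irr_limit r s n) y"
proof -
  define M1 where "M1 = (n - 2) * (pp * pm) + (r * pm + s * pp)"
  define M2 where "M2 = (n - 2) * (pp * pm) - (r * pm + s * pp)"
  define M3 where "M3 = (n - 2) * (pp * pm) - (r * pm - s * pp)"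
  define M4 where "M4 = (n - 2) * (pp * pm) + (r * pm - s * pp)"
  define E where "E = (\<lambda>t. exp (of_real pi * (Complex a t - \<epsilon>)\<^sup>2 / of_real y))"
  have I: "integrable lborel (\<lambda>t. E t * half_lattice_sum M (Complex a t))" for M
    unfolding E_def by (rule lattice_term_sums_gauss_mean(1)[OF y a])
  have irr_limit: "irr_limit r s n (Complex a t) = half_lattice_sum M1 (Complex a t) + half_lattice_sum M2 (Complex a t)
     - half_lattice_sum M3 (Complex a t) - half_lattice_sum M4 (Complex a t)" for t
    unfolding M1_def M2_def M3_def M4_def using a r by (intro irr_limit_eq_half_lattice_sum) auto
  have "(LINT t|lborel. E t * irr_limit r s n (Complex a t)) =
      (LINT t|lborel. E t * half_lattice_sum M1 (Complex a t)) + (LINT t|lborel. E t * half_lattice_sum M2 (Complex a t))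
     - (LINT t|lborel. E t * half_lattice_sum M3 (Complex a t)) - (LINT t|lborel. E t * half_lattice_sum M4 (Complex a t))"
    unfolding irr_limit distrib_left right_diff_distrib by (simp add: I)
  hence G: "gauss_mean \<epsilon> a (irr_limit r s n) y = gauss_mean \<epsilon> a (half_lattice_sum M1) y + gauss_mean \<epsilon> a (half_lattice_sum M2) y
     - gauss_mean \<epsilon> a (half_lattice_sum M3) y - gauss_mean \<epsilon> a (half_lattice_sum M4) y"
    by (simp add: gauss_mean_def E_def add_divide_distrib diff_divide_distrib)
  have "irr_term \<epsilon> y r s n = (\<lambda>k. of_nat (k + 1) * lattice_term \<epsilon> y (M1 - 2 * int k * (pp * pm))
      + of_nat (k + 1) * lattice_term \<epsilon> y (M2 - 2 * int k * (pp * pm))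
      - of_nat (k + 1) * lattice_term \<epsilon> y (M3 - 2 * int k * (pp * pm))
      - of_nat (k + 1) * lattice_term \<epsilon> y (M4 - 2 * int k * (pp * pm)))"
  proof -
    have shift: "(n - 2 * int k - 2) * (pp * pm) + x = (n - 2) * (pp * pm) + x - 2 * int k * (pp * pm)"
         "(n - 2 * int k - 2) * (pp * pm) - x = (n - 2) * (pp * pm) - x - 2 * int k * (pp * pm)" for k x
      by (simp_all add: algebra_simps)
    show ?thesis
      unfolding irr_term_def distrib_left [symmetric] right_diff_distrib [symmetric] M1_def M2_def M3_def M4_def
        shift ..
  qed
  thus ?thesis unfolding G
    by (simp only:) (intro sums_add sums_diff lattice_term_sums_gauss_mean(2)[OF y a])
qed

text \<open>
  A zero of \<open>[e]_x\<close> at \<open>x = u ^ d\<close> with \<open>d * e = P\<close> forces \<open>u ^ (2 * P) = 1\<close>, so \<open>z = i * m / \<alpha>\<close>. If \<open>P\<close>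
  divides \<open>m\<close>, then \<open>x\<^sup>2 = 1\<close>, where the q-number does not vanish.
\<close>

lemma q_number_fugacity_nonzero:
  assumes "\<And>m::int. \<not> pp * pm dvd m \<Longrightarrow> z \<noteq> \<i> * of_real (of_int m / \<alpha>)"
  shows "q_number (fugacity z powi pm) pp \<noteq> 0" "q_number (fugacity z powi pp) pm \<noteq> 0"
proof -
  have *: "q_number (fugacity z powi d) e \<noteq> 0" if de: "d > 0" "e > 0" "d * e = pp * pm" for d e
  proof
    assume 0: "q_number (fugacity z powi d) e = 0"
    note root = q_number_root_of_unity_order[OF _ de(2) 0]
    have "fugacity z powi (2 * (pp * pm)) = 1"
      using root(1) unfolding power_int_mult[symmetric] de(3)[symmetric] by (simp add: algebra_simps)
    hence "exp (2 * of_real pi * z * of_real (of_int (2 * (pp * pm)) / \<alpha>)) = 1"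
      unfolding exp_eq_fugacity .
    moreover have "of_int (2 * (pp * pm)) / \<alpha> = \<alpha>"
      using alpha_pos alpha_sq by (simp add: field_simps power2_eq_square)
    ultimately have "exp (2 * of_real pi * z * of_real \<alpha>) = 1" by (simp only:)
    then obtain m :: int where m: "2 * of_real pi * z * of_real \<alpha> = of_int (2 * m) * (of_real pi * \<i>)"
      unfolding exp_eq_1 by (auto simp: complex_eq_iff)
    hence z: "z = \<i> * of_real (of_int m / \<alpha>)"
      using alpha_pos by (simp add: field_simps)
    with assms have "pp * pm dvd m" by blast
    then obtain j where j: "m = j * (d * e)" using de by (metis dvd_def mult.commute)
    have "(fugacity z powi d) powi 2 = fugacity z powi (2 * d)"
      by (subst power_int_mult [symmetric]) (simp add: mult.commute)
    also have "\<dots> = exp (2 * of_real pi * z * of_real (of_int (2 * d) / \<alpha>))" by (simp only: exp_eq_fugacity)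
    also have "2 * of_real pi * z * of_real (of_int (2 * d) / \<alpha>) = of_int (2 * (j * d)) * (of_real pi * \<i>)"
    proof -
      have "real_of_int m * of_int (2 * d) / \<alpha>\<^sup>2 = of_int (j * d)"
        using de(1,2) unfolding alpha_sq j de(3)[symmetric] by simp
      hence "complex_of_real (of_int m * of_int (2 * d) / \<alpha>\<^sup>2) = of_real (of_int (j * d))" by simp
      moreover have "2 * of_real pi * z * of_real (of_int (2 * d) / \<alpha>)
          = 2 * of_real pi * \<i> * complex_of_real (of_int m * of_int (2 * d) / \<alpha>\<^sup>2)"
        unfolding z by (simp add: power2_eq_square)
      ultimately show ?thesis by simp
    qed
    also have "exp (of_int (2 * (j * d)) * (of_real pi * \<i>)) = (1 :: complex)"
      unfolding exp_eq_1 by (intro conjI exI[of _ "j * d"]) simp_all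
    finally show False using root(2) by simp
  qed
  show "q_number (fugacity z powi pm) pp \<noteq> 0" "q_number (fugacity z powi pp) pm \<noteq> 0"
    using pp pm by (intro *; simp)+
qed

section \<open>Limits of the characters\<close>

text \<open>
  The cone \<open>\<kappa> * \<bar>Im (z - \<epsilon>)\<bar> \<le> Re (z - \<epsilon>)\<close> with apex \<open>\<epsilon>\<close> meets the imaginary axis, if
  at all, in a segment of half width \<open>- Re \<epsilon> / \<kappa>\<close> about \<open>Im \<epsilon>\<close>. The condition says that no possible pole lies in it.
\<close>

definition pole_free_cone :: "complex \<Rightarrow> bool" where
  "pole_free_cone \<epsilon> \<longleftrightarrow> (\<exists>\<kappa>. 0 < \<kappa> \<and> \<kappa> < 1 \<and>
     (\<forall>m::int. \<not> pp * pm dvd m \<longrightarrow> - Re \<epsilon> < \<kappa> * \<bar>of_int m / \<alpha> - Im \<epsilon>\<bar>))"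

lemma irr_term_tendsto:
  assumes adm: "pole_free_cone \<epsilon>" and rs: "r \<ge> 0" "s \<ge> 0"
  shows "((\<lambda>y. \<Sum>k. irr_term \<epsilon> y r s n k) \<longlongrightarrow> irr_limit r s n \<epsilon>) (at_right 0)"
proof -
  \<comment> \<open>A line to the right of the centre and inside the half plane \<open>Re z > 0\<close>, where the series converges.\<close>
  define a where "a = \<bar>Re \<epsilon>\<bar> + 1"
  have a: "a > 0" "Re \<epsilon> < a" by (simp_all add: a_def)
  define U where "U = {z. q_number (fugacity z powi pm) pp \<noteq> 0} \<inter> {z. q_number (fugacity z powi pp) pm \<noteq> 0}"
  have hol: "(\<lambda>z. q_number (fugacity z powi d) e) holomorphic_on A" for d e A
    using alpha_pos unfolding fugacity_def by (intro holomorphic_intros) auto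
  have U: "open U"
    unfolding U_def
    by (intro open_Int open_Collect_neq continuous_on_const holomorphic_on_imp_continuous_on hol)
  have HIhol: "irr_limit r s n holomorphic_on U"
    unfolding irr_limit_def[abs_def] fugacity_def using alpha_pos
    by (intro holomorphic_intros hol[unfolded fugacity_def]) (auto simp: U_def fugacity_def)
  have inU: "z \<in> U" if "\<And>m::int. \<not> pp * pm dvd m \<Longrightarrow> z \<noteq> \<i> * of_real (of_int m / \<alpha>)" for z
    unfolding U_def using q_number_fugacity_nonzero[OF that] by simp
  obtain \<kappa> where \<kappa>: "0 < \<kappa>" "\<kappa> < 1"
    "\<And>m::int. \<not> pp * pm dvd m \<Longrightarrow> - Re \<epsilon> < \<kappa> * \<bar>of_int m / \<alpha> - Im \<epsilon>\<bar>"
    using adm unfolding pole_free_cone_def by blast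
  define B where "B = (\<lambda>M. exp (2 * pi * a * (of_int M / \<alpha>)) / (1 - exp (2 * pi * a * (of_int (- (2 * (pp * pm))) / \<alpha>)))\<^sup>2)"
  define M1 where "M1 = (n - 2) * (pp * pm) + (r * pm + s * pp)"
  define M2 where "M2 = (n - 2) * (pp * pm) - (r * pm + s * pp)"
  define M3 where "M3 = (n - 2) * (pp * pm) - (r * pm - s * pp)"
  define M4 where "M4 = (n - 2) * (pp * pm) + (r * pm - s * pp)"
  have bound: "norm (irr_limit r s n (Complex a t)) \<le> B M1 + B M2 + B M3 + B M4" for t
  proof -
    have irr_limit: "irr_limit r s n (Complex a t) = half_lattice_sum M1 (Complex a t) + half_lattice_sum M2 (Complex a t)
       - half_lattice_sum M3 (Complex a t) - half_lattice_sum M4 (Complex a t)"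
      unfolding M1_def M2_def M3_def M4_def using a rs by (intro irr_limit_eq_half_lattice_sum) auto
    have "norm (half_lattice_sum M (Complex a t)) \<le> B M" for M
      unfolding B_def by (rule norm_half_lattice_sum_le[OF a(1)])
    thus ?thesis unfolding irr_limit
      by (intro order_trans[OF norm_triangle_ineq4] add_mono order_trans[OF norm_triangle_ineq])
  qed
  have "(gauss_mean \<epsilon> a (irr_limit r s n) \<longlongrightarrow> irr_limit r s n \<epsilon>) (at_right 0)"
  proof (rule gauss_mean_tendsto[OF a(2) \<kappa>(1,2) HIhol U _ _ bound])
    fix z assume z: "\<kappa> * \<bar>Im z - Im \<epsilon>\<bar> \<le> Re z - Re \<epsilon>"
    show "z \<in> U"
    proof (rule inU)
      fix m :: int assume "\<not> pp * pm dvd m"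
      from \<kappa>(3)[OF this] z show "z \<noteq> \<i> * of_real (of_int m / \<alpha>)" by auto
    qed
  next
    show "Complex a t \<in> U" for t
      by (rule inU) (use a in \<open>auto simp: complex_eq_iff\<close>)
  qed
  moreover have "\<forall>\<^sub>F y in at_right 0. gauss_mean \<epsilon> a (irr_limit r s n) y = (\<Sum>k. irr_term \<epsilon> y r s n k)"
    using eventually_at_right_less[of 0]
    by eventually_elim (use irr_term_sums_gauss_mean[OF _ a(1) rs] sums_unique in blast)
  ultimately show ?thesis by (rule Lim_transform_eventually)
qed

lemma pole_free_cone_0: "pole_free_cone 0"
  unfolding pole_free_cone_def
proof (intro exI[of _ "1/2"] conjI allI impI)
  fix m :: int assume "\<not> pp * pm dvd m"
  hence "m \<noteq> 0" by auto
  thus "- Re 0 < 1 / 2 * \<bar>of_int m / \<alpha> - Im 0\<bar>" using alpha_pos by simp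
qed auto

lemma irr_limit_at_0: "irr_limit r s n 0 = irr_limit r s 0 0"
  by (simp add: irr_limit_def fugacity_def)

lemma lattice_term_even: "lattice_term 0 y (- N) = lattice_term 0 y N"
  by (simp add: lattice_term_def gauss_term_def)

text \<open>
  The lattice \<open>b + 2 * P * k\<close>, \<open>k\<close> an integer, is cut at \<open>k = 0\<close> and the upper half reflected, so that both halves
  run downwards like the Fock modules in the characters.
\<close>

lemma theta_eq:
  assumes y: "y > 0"
  shows "theta (pp * pm) b (\<i> * of_real y) =
    (\<Sum>k. lattice_term 0 y (- b - 2 * int k * (pp * pm))) + (\<Sum>k. lattice_term 0 y (b - 2 * (pp * pm) - 2 * int k * (pp * pm)))"
proof -
  define f where "f = (\<lambda>k. lattice_term 0 y (b + 2 * k * (pp * pm)))"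
  have ii: "2 * of_real pi * \<i> * (\<i> * of_real y) * c = - (complex_of_real pi * of_real y * (2 * c))" for c
    by simp
  have f: "qpow (\<i> * of_real y) (of_int (pp * pm) * (of_int k + of_int b / (2 * of_int (pp * pm)))\<^sup>2) = f k" for k
  proof -
    define P where "P = real_of_int (pp * pm)"
    have P: "P > 0" using P_pos unfolding P_def by (simp only: of_int_0_less_iff)
    define X where "X = of_int k + of_int b / (2 * P)"
    have X: "2 * P * X\<^sup>2 = (of_int (b + 2 * k * (pp * pm)) / \<alpha>)\<^sup>2"
      unfolding power_divide alpha_sq P_def[symmetric] X_def
      using P by (simp add: field_simps power2_eq_square) (simp add: P_def algebra_simps)
    have "complex_of_int (pp * pm) = of_real P" by (simp add: P_def)
    moreover from this have "of_int k + of_int b / (2 * complex_of_int (pp * pm)) = of_real X"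
      unfolding X_def by (simp only: of_real_add of_real_divide of_real_mult of_real_of_int_eq of_real_numeral)
    ultimately have "qpow (\<i> * of_real y) (of_int (pp * pm) * (of_int k + of_int b / (2 * of_int (pp * pm)))\<^sup>2)
       = exp (2 * of_real pi * \<i> * (\<i> * of_real y) * (of_real P * (of_real X)\<^sup>2))"
      unfolding qpow_def by (simp only:)
    also have "2 * of_real pi * \<i> * (\<i> * of_real y) * (of_real P * (of_real X)\<^sup>2)
        = - (of_real pi * of_real y * (2 * (of_real P * (complex_of_real X)\<^sup>2)))"
      by (rule ii)
    also have "\<dots> = - complex_of_real (pi * y * (2 * P * X\<^sup>2))"
      by (simp only: of_real_mult of_real_power of_real_numeral mult.assoc)
    finally show ?thesis unfolding X f_def lattice_term_def gauss_term_def
      by (simp only: mult_zero_right mult_zero_left diff_0)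
  qed
  have abs: "((\<lambda>k. lattice_term 0 y (M - 2 * int k * (pp * pm))) has_sum (\<Sum>k. lattice_term 0 y (M - 2 * int k * (pp * pm)))) UNIV" for M
  proof (rule norm_summable_imp_has_sum)
    define g where "g = (\<lambda>k. exp (- (pi * y * (of_int (M - 2 * int k * (pp * pm)) / \<alpha>)\<^sup>2)))"
    have g: "lattice_term 0 y (M - 2 * int k * (pp * pm)) = of_real (g k)" for k
      unfolding lattice_term_def gauss_term_def g_def exp_of_real [symmetric] by simp
    have "summable g" using summable_lattice_term(2)[OF y, of 0 M] unfolding g summable_complex_of_real .
    thus "summable (\<lambda>k. norm (lattice_term 0 y (M - 2 * int k * (pp * pm))))" unfolding g by (simp add: g_def)
  qed (rule summable_sums[OF summable_lattice_term(2)[OF y]])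
  have 1: "(f has_sum (\<Sum>k. lattice_term 0 y (- b - 2 * int k * (pp * pm)))) (range int)"
  proof (subst has_sum_reindex)
    have "f \<circ> int = (\<lambda>k. lattice_term 0 y (- b - 2 * int k * (pp * pm)))"
    proof
      fix k show "(f \<circ> int) k = lattice_term 0 y (- b - 2 * int k * (pp * pm))"
        using lattice_term_even[of y "b + 2 * int k * (pp * pm)"] by (simp add: f_def)
    qed
    thus "(f \<circ> int has_sum (\<Sum>k. lattice_term 0 y (- b - 2 * int k * (pp * pm)))) UNIV" using abs by simp
  qed auto
  have 2: "(f has_sum (\<Sum>k. lattice_term 0 y (b - 2 * (pp * pm) - 2 * int k * (pp * pm)))) (range (\<lambda>k. - int k - 1))"
  proof (subst has_sum_reindex)
    have "f \<circ> (\<lambda>k. - int k - 1) = (\<lambda>k. lattice_term 0 y (b - 2 * (pp * pm) - 2 * int k * (pp * pm)))"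
      by (auto simp: f_def algebra_simps)
    thus "(f \<circ> (\<lambda>k. - int k - 1) has_sum (\<Sum>k. lattice_term 0 y (b - 2 * (pp * pm) - 2 * int k * (pp * pm)))) UNIV"
      using abs by simp
  qed (auto simp: inj_on_def)
  have "UNIV = range int \<union> range (\<lambda>k. - int k - 1)"
  proof (intro set_eqI iffI)
    fix x :: int
    show "x \<in> range int \<union> range (\<lambda>k. - int k - 1)"
    proof (cases "x \<ge> 0")
      case True
      hence "x = int (nat x)" by simp
      thus ?thesis by blast
    next
      case False
      hence "x = - int (nat (- x - 1)) - 1" by simp
      thus ?thesis by blast
    qed
  qed auto
  moreover have "(f has_sum (\<Sum>k. lattice_term 0 y (- b - 2 * int k * (pp * pm)))
     + (\<Sum>k. lattice_term 0 y (b - 2 * (pp * pm) - 2 * int k * (pp * pm)))) (range int \<union> range (\<lambda>k. - int k - 1))"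
    by (rule has_sum_Un_disjoint[OF 1 2]) auto
  ultimately show ?thesis
    unfolding theta_def f by (metis infsumI)
qed

text \<open>
  The theta difference is the four-term sum for \<open>pp - r, s\<close> with constant weight, hence by parts the difference of
  the sums with \<open>n = 1\<close> and \<open>n = - 1\<close> at \<open>\<epsilon> = 0\<close>. The cone condition holds at 0, and there the two limits agree
  because \<open>u = 1\<close>.
\<close>

lemma ch_minimal_tendsto:
  assumes "0 \<le> r" "r \<le> pp" "0 \<le> s"
  shows "((\<lambda>y. dedekind_eta (\<i> * of_real y) * ch_minimal pp pm r s (\<i> * of_real y)) \<longlongrightarrow> 0) (at_right 0)"
proof -
  \<comment> \<open>Reflecting \<open>r\<close> moves the theta lattices \<open>2 * P * k + b\<close> to odd multiples of \<open>P\<close>, as in \<open>irr_term\<close> with odd \<open>n\<close>.\<close>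
  define r' where "r' = pp - r"
  have r': "r' \<ge> 0" using assms by (simp add: r'_def)
  have eq: "(\<Sum>k. irr_term 0 y r' s 1 k) - (\<Sum>k. irr_term 0 y r' s (- 1) k) =
      dedekind_eta (\<i> * of_real y) * ch_minimal pp pm r s (\<i> * of_real y)" if y: "y > 0" for y
  proof -
    define b where "b = r * pm - s * pp"
    define c where "c = r * pm + s * pp"
    define t where "t = (\<lambda>M k. lattice_term 0 y (M - 2 * int k * (pp * pm)))"
    define f where "f = (\<lambda>k. t (- b) k + t (b - 2 * (pp * pm)) k - t (c - 2 * (pp * pm)) k - t (- c) k)"
    have t: "summable (t M)" "summable (\<lambda>k. of_nat (k + 1) * t M k)" for M
      unfolding t_def using summable_lattice_term[OF y] by blast+
    have sf: "summable f" unfolding f_def by (intro summable_add summable_diff t)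
    have sf': "summable (\<lambda>k. of_nat (k + 1) * f k)"
      unfolding f_def distrib_left right_diff_distrib by (intro summable_add summable_diff t)
    have "suminf f = suminf (t (- b)) + suminf (t (b - 2 * (pp * pm))) - suminf (t (c - 2 * (pp * pm))) - suminf (t (- c))"
      unfolding f_def by (simp add: t summable_add summable_diff flip: suminf_add suminf_diff)
    also have "\<dots> = theta (pp * pm) b (\<i> * of_real y) - theta (pp * pm) c (\<i> * of_real y)"
      unfolding theta_eq[OF y] by (simp add: t_def)
    also have "\<dots> = dedekind_eta (\<i> * of_real y) * ch_minimal pp pm r s (\<i> * of_real y)"
      using dedekind_eta_nonzero[OF y] by (simp add: ch_minimal_def b_def c_def)
    finally have 1: "suminf f = \<dots>" .
    have "(\<lambda>k. irr_term 0 y r' s 1 k - irr_term 0 y r' s (- 1) k) = (\<lambda>k. of_nat (k + 1) * (f k - f (k + 1)))"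
    proof
      fix k
      have e: "(1 - 2 * int k - 2) * (pp * pm) + (r' * pm + s * pp) = - b - 2 * int k * (pp * pm)"
        "(1 - 2 * int k - 2) * (pp * pm) - (r' * pm + s * pp) = b - 2 * (pp * pm) - 2 * int k * (pp * pm)"
        "(1 - 2 * int k - 2) * (pp * pm) - (r' * pm - s * pp) = c - 2 * (pp * pm) - 2 * int k * (pp * pm)"
        "(1 - 2 * int k - 2) * (pp * pm) + (r' * pm - s * pp) = - c - 2 * int k * (pp * pm)"
        "(- 1 - 2 * int k - 2) * (pp * pm) + (r' * pm + s * pp) = - b - 2 * int (k + 1) * (pp * pm)"
        "(- 1 - 2 * int k - 2) * (pp * pm) - (r' * pm + s * pp) = b - 2 * (pp * pm) - 2 * int (k + 1) * (pp * pm)"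
        "(- 1 - 2 * int k - 2) * (pp * pm) - (r' * pm - s * pp) = c - 2 * (pp * pm) - 2 * int (k + 1) * (pp * pm)"
        "(- 1 - 2 * int k - 2) * (pp * pm) + (r' * pm - s * pp) = - c - 2 * int (k + 1) * (pp * pm)"
        by (simp_all add: b_def c_def r'_def algebra_simps)
      show "irr_term 0 y r' s 1 k - irr_term 0 y r' s (- 1) k = of_nat (k + 1) * (f k - f (k + 1))"
        unfolding irr_term_def f_def t_def e right_diff_distrib [symmetric]
        by (intro arg_cong2[of _ _ _ _ "(*)"] arg_cong2[of _ _ _ _ "(-)"] refl)
    qed
    hence "(\<lambda>k. irr_term 0 y r' s 1 k - irr_term 0 y r' s (- 1) k) sums suminf f"
      using sums_by_parts[OF sf sf'] by simp
    moreover have "irr_term 0 y r' s 1 sums (\<Sum>k. irr_term 0 y r' s 1 k)" "irr_term 0 y r' s (- 1) sums (\<Sum>k. irr_term 0 y r' s (- 1) k)"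
      using irr_term_sums_gauss_mean[OF y zero_less_one r' assms(3)] by (metis sums_unique)+
    ultimately show ?thesis unfolding 1 [symmetric] by (metis sums_diff sums_unique2)
  qed
  have "((\<lambda>y. (\<Sum>k. irr_term 0 y r' s 1 k) - (\<Sum>k. irr_term 0 y r' s (- 1) k)) \<longlongrightarrow> irr_limit r' s 1 0 - irr_limit r' s (- 1) 0) (at_right 0)"
    by (intro tendsto_diff irr_term_tendsto pole_free_cone_0 r' assms)
  hence "((\<lambda>y. (\<Sum>k. irr_term 0 y r' s 1 k) - (\<Sum>k. irr_term 0 y r' s (- 1) k)) \<longlongrightarrow> 0) (at_right 0)"
    using irr_limit_at_0[of r' s 1] irr_limit_at_0[of r' s "-1"] by simp
  thus ?thesis
    by (rule Lim_transform_eventually) (use eventually_at_right_less[of 0] eq in \<open>auto elim: eventually_mono\<close>)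
qed

lemma ch_Fock_rsn_eq':
  assumes "y > 0"
  shows "ch_Fock_rsn pp pm \<epsilon> r s n (\<i> * of_real y) =
     lattice_term \<epsilon> y (n * (pp * pm) - r * pm + s * pp) / dedekind_eta (\<i> * of_real y)"
  using ch_Fock_rsn_eq[OF assms, of \<epsilon> r s n] dedekind_eta_nonzero[OF assms] by (simp add: field_simps)

text \<open>
  One formula covers the interior and the border: at \<open>s = pm\<close> (or \<open>r = pp\<close>) the four terms telescope in \<open>k\<close>, and at
  \<open>r = pp\<close>, \<open>s = pm\<close> the quotient \<open>irr_limit\<close> collapses to a single power of \<open>u\<close>.
\<close>

lemma ch_I_tendsto:
  assumes adm: "pole_free_cone \<epsilon>" and re: "Re \<epsilon> \<noteq> 0" and r: "1 \<le> r" "r \<le> pp" and s: "1 \<le> s" "s \<le> pm"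
  shows "((\<lambda>y. dedekind_eta (\<i> * of_real y) * ch_I pp pm \<epsilon> r s n (\<i> * of_real y)) \<longlongrightarrow> irr_limit r s n \<epsilon>) (at_right 0)"
proof -
  let ?P = "pp * pm"
  let ?S = "\<lambda>y. \<Sum>k. irr_term \<epsilon> y r s n k"
  have lim: "(?S \<longlongrightarrow> irr_limit r s n \<epsilon>) (at_right 0)"
    using r s by (intro irr_term_tendsto adm) auto
  have It: "irr_term \<epsilon> y r s n sums ?S y" if "y > 0" for y
    using irr_term_sums_gauss_mean[OF that zero_less_one] r s by (metis sums_unique order_trans zero_le_one)
  define t where "t = (\<lambda>y M k. lattice_term \<epsilon> y (M - 2 * int k * ?P))"
  have t: "summable (t y M)" "summable (\<lambda>k. of_nat (k + 1) * t y M k)" if "y > 0" for y M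
    unfolding t_def using summable_lattice_term[OF that] by blast+
  have parts: "suminf f = ?S y" if y: "y > 0" and f: "f = (\<lambda>k. t y M k - t y M' k)"
      and eq: "\<And>k. irr_term \<epsilon> y r s n k = of_nat (k + 1) * (f k - f (k + 1))" for y f M M'
  proof -
    have "summable f" unfolding f by (intro summable_diff t y)
    moreover have "summable (\<lambda>k. of_nat (k + 1) * f k)"
      unfolding f right_diff_distrib by (intro summable_diff t y)
    ultimately have "(\<lambda>k. of_nat (k + 1) * (f k - f (k + 1))) sums suminf f" by (rule sums_by_parts)
    thus ?thesis using It[OF y] unfolding eq[symmetric] by (rule sums_unique2)
  qed
  consider "r < pp" "s < pm" | "r < pp" "s = pm" | "r = pp" "s < pm" | "r = pp" "s = pm" using r s by linarith
  thus ?thesis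
  proof cases
    case 1
    define e where "e = (\<lambda>s y. dedekind_eta (\<i> * of_real y) * ch_minimal pp pm r s (\<i> * of_real y))"
    have e: "(e s \<longlongrightarrow> 0) (at_right 0)" "(e (pm - s) \<longlongrightarrow> 0) (at_right 0)"
      unfolding e_def using r s by (auto intro!: ch_minimal_tendsto)
    have "((\<lambda>y. of_int n * of_bool (n \<ge> 0) * (of_bool (even n) * e s y - of_bool (odd n) * e (pm - s) y) + ?S y)
       \<longlongrightarrow> of_int n * of_bool (n \<ge> 0) * (of_bool (even n) * 0 - of_bool (odd n) * 0) + irr_limit r s n \<epsilon>) (at_right 0)"
      by (intro tendsto_intros e lim)
    hence "((\<lambda>y. of_int n * of_bool (n \<ge> 0) * (of_bool (even n) * e s y - of_bool (odd n) * e (pm - s) y) + ?S y)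
       \<longlongrightarrow> irr_limit r s n \<epsilon>) (at_right 0)" by simp
    moreover have "of_int n * of_bool (n \<ge> 0) * (of_bool (even n) * e s y - of_bool (odd n) * e (pm - s) y) + ?S y
       = dedekind_eta (\<i> * of_real y) * ch_I pp pm \<epsilon> r s n (\<i> * of_real y)" if y: "y > 0" for y
    proof -
      let ?F = "\<lambda>r s n. ch_Fock_rsn pp pm \<epsilon> r s n (\<i> * of_real y)"
      have "of_nat (k + 1) * (?F (pp - r) s (n - 2 * int k - 1) + ?F r (pm - s) (n - 2 * int k - 3)
         - ?F r s (n - 2 * int k - 2) - ?F (pp - r) (pm - s) (n - 2 * int k - 2))
           = irr_term \<epsilon> y r s n k / dedekind_eta (\<i> * of_real y)" for k
      proof -
        have "(n - 2 * int k - 1) * ?P - (pp - r) * pm + s * pp = (n - 2 * int k - 2) * ?P + (r * pm + s * pp)"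
          "(n - 2 * int k - 3) * ?P - r * pm + (pm - s) * pp = (n - 2 * int k - 2) * ?P - (r * pm + s * pp)"
          "(n - 2 * int k - 2) * ?P - r * pm + s * pp = (n - 2 * int k - 2) * ?P - (r * pm - s * pp)"
          "(n - 2 * int k - 2) * ?P - (pp - r) * pm + (pm - s) * pp = (n - 2 * int k - 2) * ?P + (r * pm - s * pp)"
          by (simp_all add: algebra_simps)
        thus ?thesis
          unfolding ch_Fock_rsn_eq'[OF y] irr_term_def
          by (simp only: add_divide_distrib [symmetric] diff_divide_distrib [symmetric] times_divide_eq_right)
      qed
      moreover have "(\<Sum>k. irr_term \<epsilon> y r s n k / dedekind_eta (\<i> * of_real y)) = ?S y / dedekind_eta (\<i> * of_real y)"
        using sums_divide[OF It[OF y]] by (rule sums_unique [symmetric])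
      ultimately show ?thesis
        using 1 dedekind_eta_nonzero[OF y] by (simp add: ch_I_def e_def algebra_simps)
    qed
    ultimately show ?thesis
      by (elim Lim_transform_eventually) (use eventually_at_right_less[of 0] in \<open>auto elim: eventually_mono\<close>)
  next
    case 2
    have "?S y = dedekind_eta (\<i> * of_real y) * ch_I pp pm \<epsilon> r s n (\<i> * of_real y)" if y: "y > 0" for y
    proof -
      let ?F = "\<lambda>r s n. ch_Fock_rsn pp pm \<epsilon> r s n (\<i> * of_real y)"
      define f where "f = (\<lambda>k. t y ((n - 1) * ?P + r * pm) k - t y ((n - 1) * ?P - r * pm) k)"
      have f: "suminf f = ?S y"
        by (rule parts[OF y f_def]) (simp add: irr_term_def f_def t_def \<open>s = pm\<close>, simp add: algebra_simps)
      have "summable f" unfolding f_def by (intro summable_diff t y)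
      hence "(\<Sum>k. f k / dedekind_eta (\<i> * of_real y)) = suminf f / dedekind_eta (\<i> * of_real y)"
        by (rule suminf_divide)
      moreover have "?F (pp - r) pm (n - 2 * int k - 1) - ?F r pm (n - 2 * int k - 2) = f k / dedekind_eta (\<i> * of_real y)" for k
        unfolding ch_Fock_rsn_eq'[OF y] f_def t_def diff_divide_distrib by (simp add: algebra_simps)
      ultimately show ?thesis using 2 dedekind_eta_nonzero[OF y] f by (simp add: ch_I_def)
    qed
    with lim show ?thesis
      by (elim Lim_transform_eventually) (use eventually_at_right_less[of 0] in \<open>auto elim: eventually_mono\<close>)
  next
    case 3
    have "?S y = dedekind_eta (\<i> * of_real y) * ch_I pp pm \<epsilon> r s n (\<i> * of_real y)" if y: "y > 0" for y
    proof -
      let ?F = "\<lambda>r s n. ch_Fock_rsn pp pm \<epsilon> r s n (\<i> * of_real y)"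
      define f where "f = (\<lambda>k. t y ((n - 1) * ?P + s * pp) k - t y ((n - 1) * ?P - s * pp) k)"
      have f: "suminf f = ?S y"
        by (rule parts[OF y f_def]) (simp add: irr_term_def f_def t_def \<open>r = pp\<close>, simp add: algebra_simps)
      have "summable f" unfolding f_def by (intro summable_diff t y)
      hence "(\<Sum>k. f k / dedekind_eta (\<i> * of_real y)) = suminf f / dedekind_eta (\<i> * of_real y)"
        by (rule suminf_divide)
      moreover have "?F pp s (n - 2 * int k) - ?F pp (pm - s) (n - 2 * int k - 1) = f k / dedekind_eta (\<i> * of_real y)" for k
        unfolding ch_Fock_rsn_eq'[OF y] f_def t_def diff_divide_distrib by (simp add: algebra_simps)
      ultimately show ?thesis using 3 dedekind_eta_nonzero[OF y] f by (simp add: ch_I_def)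
    qed
    with lim show ?thesis
      by (elim Lim_transform_eventually) (use eventually_at_right_less[of 0] in \<open>auto elim: eventually_mono\<close>)
  next
    case 4
    have HI4: "irr_limit r s n \<epsilon> = fugacity \<epsilon> powi (n * ?P)"
      using 4 re pp pm q_number_frac[of \<epsilon> pm pp] q_number_frac[of \<epsilon> pp pm]
        q_number_frac(2)[of \<epsilon> ?P 0] P_pos
      by (simp add: irr_limit_def mult.commute[of pm pp])
    have lim4: "((\<lambda>y. lattice_term \<epsilon> y (n * ?P)) \<longlongrightarrow> fugacity \<epsilon> powi (n * ?P)) (at_right 0)"
    proof -
      have "((\<lambda>y. lattice_term \<epsilon> y (n * ?P)) \<longlongrightarrow> exp (2 * of_real pi * \<epsilon> * of_real (of_int (n * ?P) / \<alpha>)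
         - of_real (pi * 0 * (of_int (n * ?P) / \<alpha>)\<^sup>2))) (at_right 0)"
        unfolding lattice_term_def gauss_term_def by (intro tendsto_intros)
      thus ?thesis unfolding exp_eq_fugacity [symmetric] by simp
    qed
    have eq4: "lattice_term \<epsilon> y (n * ?P) = dedekind_eta (\<i> * of_real y) * ch_I pp pm \<epsilon> r s n (\<i> * of_real y)" if "y > 0" for y
      using 4 ch_Fock_rsn_eq[OF that, of \<epsilon> pp pm n] by (simp add: ch_I_def mult.commute[of pm pp])
    show ?thesis
      unfolding HI4 by (rule Lim_transform_eventually[OF lim4])
        (use eventually_at_right_less[of 0] eq4 in \<open>auto elim: eventually_mono\<close>)
  qed
qed

section \<open>Quantum dimensions and fusion rules\<close>

definition Fock_limit :: "complex \<Rightarrow> complex \<Rightarrow> complex" where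
  "Fock_limit \<epsilon> l = exp (2 * of_real pi * \<epsilon> * (l - of_real (alpha_zero pp pm) / 2))"

text \<open>
  The inverse of \<open>irr_limit 1 1 0\<close>.
\<close>

definition inv_vacuum_limit :: "complex \<Rightarrow> complex" where
  "inv_vacuum_limit \<epsilon> = q_number (fugacity \<epsilon> powi pm) pp * q_number (fugacity \<epsilon> powi pp) pm"

lemma inv_vacuum_limit_nonzero: "Re \<epsilon> \<noteq> 0 \<Longrightarrow> inv_vacuum_limit \<epsilon> \<noteq> 0"
  using pp pm q_number_fugacity_nonzero[of \<epsilon>] by (force simp: inv_vacuum_limit_def)

text \<open>
  Since the infimum \<open>d\<close> of the distances satisfies \<open>- Re \<epsilon> < d\<close> strictly, there is room for a slope
  \<open>\<kappa> < 1\<close> with \<open>- Re \<epsilon> < \<kappa> * d\<close>.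
\<close>

lemma B_bound_imp_pole_free_cone:
  assumes B: "Re \<epsilon> > B_bound pp pm \<epsilon>"
  shows "pole_free_cone \<epsilon>"
proof -
  define S where "S = {\<bar>real_of_int m / \<alpha> - Im \<epsilon>\<bar> |m::int. \<not> pp * pm dvd m}"
  define d where "d = Inf S"
  have Bd: "B_bound pp pm \<epsilon> = - d"
    by (simp add: B_bound_def d_def S_def alpha_full_def)
  have "\<not> pp * pm dvd 1" using pp pm P_pos by (auto simp: zdvd1_eq zmult_eq_1_iff)
  hence ne: "S \<noteq> {}" unfolding S_def by blast
  have d0: "d \<ge> 0" unfolding d_def using ne by (rule cInf_greatest) (auto simp: S_def)
  have low: "d \<le> \<bar>of_int m / \<alpha> - Im \<epsilon>\<bar>" if "\<not> pp * pm dvd m" for m :: int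
    unfolding d_def by (rule cInf_lower) (use that in \<open>auto simp: S_def intro!: bdd_belowI[of _ 0]\<close>)
  obtain \<kappa> where \<kappa>: "0 < \<kappa>" "\<kappa> < 1" "- Re \<epsilon> < \<kappa> * d"
  proof (cases "d = 0")
    case True
    thus ?thesis using that[of "1/2"] B Bd by simp
  next
    case False
    hence d: "d > 0" using d0 by simp
    have "- Re \<epsilon> < d" using B Bd by simp
    hence "- Re \<epsilon> / d < 1" using d by (simp only: divide_less_eq_1_pos)
    \<comment> \<open>The maximum with 0 is needed since \<open>Re \<epsilon>\<close> may be positive.\<close>
    hence "max 0 (- Re \<epsilon> / d) < 1" by simp
    then obtain \<kappa> where "max 0 (- Re \<epsilon> / d) < \<kappa>" "\<kappa> < 1" using dense by blast
    thus ?thesis using that[of \<kappa>] d by (simp add: field_simps)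
  qed
  show ?thesis unfolding pole_free_cone_def
  proof (intro exI[of _ \<kappa>] conjI allI impI \<kappa>(1,2))
    fix m :: int assume "\<not> pp * pm dvd m"
    from mult_left_mono[OF low[OF this], of \<kappa>] show "- Re \<epsilon> < \<kappa> * \<bar>of_int m / \<alpha> - Im \<epsilon>\<bar>" using \<kappa> by linarith
  qed
qed

lemma ch_Fock_tendsto:
  "((\<lambda>y. dedekind_eta (\<i> * of_real y) * ch_Fock pp pm \<epsilon> l (\<i> * of_real y)) \<longlongrightarrow> Fock_limit \<epsilon> l) (at_right 0)"
proof -
  have "((\<lambda>y. exp (2 * of_real pi * \<epsilon> * (l - of_real (alpha_zero pp pm) / 2)
          - of_real (pi * y) * (l - of_real (alpha_zero pp pm) / 2)\<^sup>2)) \<longlongrightarrow>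
       exp (2 * of_real pi * \<epsilon> * (l - of_real (alpha_zero pp pm) / 2)
          - of_real (pi * 0) * (l - of_real (alpha_zero pp pm) / 2)\<^sup>2)) (at_right 0)"
    by (intro tendsto_intros)
  hence "((\<lambda>y. exp (2 * of_real pi * \<epsilon> * (l - of_real (alpha_zero pp pm) / 2)
          - of_real (pi * y) * (l - of_real (alpha_zero pp pm) / 2)\<^sup>2)) \<longlongrightarrow> Fock_limit \<epsilon> l) (at_right 0)"
    by (simp add: Fock_limit_def)
  thus ?thesis
    by (rule Lim_transform_eventually)
       (use eventually_at_right_less[of 0] in \<open>auto elim!: eventually_mono simp: ch_Fock_eq simp del: of_real_mult\<close>)
qed

lemma ch_vacuum_tendsto:
  assumes adm: "pole_free_cone \<epsilon>" and re: "Re \<epsilon> \<noteq> 0"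
  shows "((\<lambda>y. dedekind_eta (\<i> * of_real y) * ch_vacuum pp pm \<epsilon> (\<i> * of_real y)) \<longlongrightarrow> 1 / inv_vacuum_limit \<epsilon>) (at_right 0)"
proof -
  have "irr_limit 1 1 0 \<epsilon> = 1 / inv_vacuum_limit \<epsilon>" by (simp add: irr_limit_def inv_vacuum_limit_def q_number_def)
  moreover have "((\<lambda>y. dedekind_eta (\<i> * of_real y) * ch_minimal pp pm 1 1 (\<i> * of_real y)
      + dedekind_eta (\<i> * of_real y) * ch_I pp pm \<epsilon> 1 1 0 (\<i> * of_real y)) \<longlongrightarrow> 0 + irr_limit 1 1 0 \<epsilon>) (at_right 0)"
    using pp pm by (intro tendsto_add ch_minimal_tendsto ch_I_tendsto assms) auto
  ultimately show ?thesis by (simp add: ch_vacuum_def distrib_left)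
qed

lemma qdim_eqI:
  assumes adm: "pole_free_cone \<epsilon>" and re: "Re \<epsilon> \<noteq> 0"
    and ch: "((\<lambda>y. dedekind_eta (\<i> * of_real y) * ch (\<i> * of_real y)) \<longlongrightarrow> L) (at_right 0)"
  shows "qdim_exists pp pm \<epsilon> ch" "qdim pp pm \<epsilon> ch = L * inv_vacuum_limit \<epsilon>"
proof -
  note vac = ch_vacuum_tendsto[OF adm re]
  have ne: "1 / inv_vacuum_limit \<epsilon> \<noteq> 0" using inv_vacuum_limit_nonzero[OF re] by simp
  have "\<forall>\<^sub>F y in at_right 0. dedekind_eta (\<i> * of_real y) * ch_vacuum pp pm \<epsilon> (\<i> * of_real y) \<noteq> 0"
    by (rule tendsto_imp_eventually_ne[OF vac ne])
  hence nz: "\<forall>\<^sub>F y in at_right 0. ch_vacuum pp pm \<epsilon> (\<i> * of_real y) \<noteq> 0"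
    by (rule eventually_mono) auto
  have "((\<lambda>y. (dedekind_eta (\<i> * of_real y) * ch (\<i> * of_real y)) /
        (dedekind_eta (\<i> * of_real y) * ch_vacuum pp pm \<epsilon> (\<i> * of_real y))) \<longlongrightarrow> L / (1 / inv_vacuum_limit \<epsilon>)) (at_right 0)"
    by (rule tendsto_divide[OF ch vac ne])
  moreover have "\<forall>\<^sub>F y in at_right 0. (dedekind_eta (\<i> * of_real y) * ch (\<i> * of_real y)) /
        (dedekind_eta (\<i> * of_real y) * ch_vacuum pp pm \<epsilon> (\<i> * of_real y)) = qdim_ratio pp pm \<epsilon> ch y"
    using eventually_at_right_less[of 0]
    by eventually_elim (simp add: qdim_ratio_def dedekind_eta_nonzero)
  ultimately have "(qdim_ratio pp pm \<epsilon> ch \<longlongrightarrow> L / (1 / inv_vacuum_limit \<epsilon>)) (at_right 0)"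
    by (rule Lim_transform_eventually)
  hence lim: "(qdim_ratio pp pm \<epsilon> ch \<longlongrightarrow> L * inv_vacuum_limit \<epsilon>) (at_right 0)" by simp
  show "qdim_exists pp pm \<epsilon> ch" using nz lim unfolding qdim_exists_def by blast
  show "qdim pp pm \<epsilon> ch = L * inv_vacuum_limit \<epsilon>" unfolding qdim_def by (rule tendsto_Lim[OF _ lim]) simp
qed

lemma qdim_Fock_eq:
  assumes "pole_free_cone \<epsilon>" "Re \<epsilon> \<noteq> 0"
  shows "qdim_Fock pp pm \<epsilon> l = Fock_limit \<epsilon> l * inv_vacuum_limit \<epsilon>"
  unfolding qdim_Fock_def by (rule qdim_eqI(2)[OF assms ch_Fock_tendsto])

lemma qdim_I_eq:
  assumes "pole_free_cone \<epsilon>" "Re \<epsilon> \<noteq> 0" "1 \<le> r" "r \<le> pp" "1 \<le> s" "s \<le> pm"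
  shows "qdim_I pp pm \<epsilon> r s n = fugacity \<epsilon> powi (n * (pp * pm)) * q_number (fugacity \<epsilon> powi pm) r * q_number (fugacity \<epsilon> powi pp) s"
proof -
  have "qdim_I pp pm \<epsilon> r s n = irr_limit r s n \<epsilon> * inv_vacuum_limit \<epsilon>"
    unfolding qdim_I_def by (rule qdim_eqI(2)[OF assms(1,2) ch_I_tendsto[OF assms]])
  thus ?thesis using inv_vacuum_limit_nonzero[OF assms(2)] by (simp add: irr_limit_def inv_vacuum_limit_def)
qed

lemma Fock_limit_shift: "Fock_limit \<epsilon> (l + of_real (of_int N / \<alpha>)) = Fock_limit \<epsilon> l * fugacity \<epsilon> powi N"
  unfolding Fock_limit_def exp_eq_fugacity [symmetric] mult_exp_exp by (simp add: algebra_simps)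

text \<open>
  Adding \<open>alpha_plus\<close> to a weight multiplies by \<open>v\<^sup>2\<close>, adding \<open>alpha_minus\<close> by \<open>w ^ (- 2)\<close>. The double sum
  therefore factors into \<open>[pp]_v\<close> and \<open>[pm]_w\<close>, and the shift by \<open>alpha_zero / 2\<close> in the two Fock characters on the
  left accounts for the symmetric centring of both q-numbers.
\<close>

lemma fusion_Fock_Fock:
  "Fock_limit \<epsilon> l * Fock_limit \<epsilon> \<mu> * inv_vacuum_limit \<epsilon> = (\<Sum>jp\<in>{0..pp - 1}. \<Sum>jm\<in>{0..pm - 1}.
     Fock_limit \<epsilon> (l + \<mu> + of_int jp * of_real (alpha_plus pp pm) + of_int jm * of_real (alpha_minus pp pm)))"
proof -
  let ?u = "fugacity \<epsilon>"
  have Fock_limit: "Fock_limit \<epsilon> l * Fock_limit \<epsilon> \<mu> = Fock_limit \<epsilon> (l + \<mu>) * ?u powi (pp - pm)"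
  proof -
    have "- alpha_zero pp pm / 2 = of_int (pp - pm) / \<alpha>"
      by (simp add: alpha_zero_def alpha_plus_eq alpha_minus_eq diff_divide_distrib)
    hence "?u powi (pp - pm) = exp (2 * of_real pi * \<epsilon> * of_real (- alpha_zero pp pm / 2))"
      unfolding exp_eq_fugacity [symmetric] by simp
    thus ?thesis unfolding Fock_limit_def by (simp add: mult_exp_exp algebra_simps)
  qed
  have "Fock_limit \<epsilon> (l + \<mu> + of_int jp * of_real (alpha_plus pp pm) + of_int jm * of_real (alpha_minus pp pm))
     = Fock_limit \<epsilon> (l + \<mu>) * ?u powi (pp - pm) * ((?u powi pm) powi (1 - pp + 2 * jp) * (?u powi pp) powi (pm - 1 - 2 * jm))" for jp jm
  proof -
    have "l + \<mu> + of_int jp * of_real (alpha_plus pp pm) + of_int jm * of_real (alpha_minus pp pm)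
        = l + \<mu> + of_real (of_int (2 * pm * jp - 2 * pp * jm) / \<alpha>)"
      by (simp add: alpha_plus_eq alpha_minus_eq diff_divide_distrib mult_ac)
    moreover have "2 * pm * jp - 2 * pp * jm = (pp - pm) + (pm * (1 - pp + 2 * jp) + pp * (pm - 1 - 2 * jm))"
      by (simp add: algebra_simps)
    ultimately show ?thesis
      by (simp only: Fock_limit_shift power_int_add[OF disjI1[OF fugacity_nonzero]] power_int_mult mult.assoc)
  qed
  hence "(\<Sum>jp\<in>{0..pp - 1}. \<Sum>jm\<in>{0..pm - 1}.
     Fock_limit \<epsilon> (l + \<mu> + of_int jp * of_real (alpha_plus pp pm) + of_int jm * of_real (alpha_minus pp pm)))
     = Fock_limit \<epsilon> (l + \<mu>) * ?u powi (pp - pm) * inv_vacuum_limit \<epsilon>"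
    unfolding inv_vacuum_limit_def q_number_def[of _ pp] q_number_reverse[of _ pm] sum_product
    by (simp only: sum_distrib_left)
  thus ?thesis unfolding Fock_limit by simp
qed

text \<open>
  The labels \<open>r - 2 * jp\<close> and \<open>s - 2 * jm\<close> enumerate the exponents of the q-numbers \<open>[r]_v\<close> and \<open>[s]_w\<close>.
\<close>

lemma fusion_I_Fock:
  "fugacity \<epsilon> powi (n * (pp * pm)) * q_number (fugacity \<epsilon> powi pm) r * q_number (fugacity \<epsilon> powi pp) s * Fock_limit \<epsilon> \<mu> =
    (\<Sum>jp\<in>{0..r - 1}. \<Sum>jm\<in>{0..s - 1}. Fock_limit \<epsilon> (\<mu> + of_real (alpha_rsn pp pm (r - 2 * jp) (s - 2 * jm) n)))"
proof -
  let ?u = "fugacity \<epsilon>"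
  have "Fock_limit \<epsilon> (\<mu> + of_real (alpha_rsn pp pm (r - 2 * jp) (s - 2 * jm) n))
     = ?u powi (n * (pp * pm)) * ((?u powi pm) powi (1 - r + 2 * jp) * (?u powi pp) powi (s - 1 - 2 * jm)) * Fock_limit \<epsilon> \<mu>" for jp jm
  proof -
    have "alpha_rsn pp pm (r - 2 * jp) (s - 2 * jm) n
       = of_int (n * (pp * pm) - (r - 2 * jp) * pm + (s - 2 * jm) * pp) / \<alpha> + alpha_zero pp pm / 2"
      using alpha_rsn_eq[of "r - 2 * jp" "s - 2 * jm" n] by linarith
    also have "\<dots> = of_int (n * (pp * pm) + (pm * (1 - r + 2 * jp) + pp * (s - 1 - 2 * jm))) / \<alpha>"
      using alpha_pos by (simp add: alpha_zero_def alpha_plus_eq alpha_minus_eq field_simps)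
    finally have "alpha_rsn pp pm (r - 2 * jp) (s - 2 * jm) n
       = of_int (n * (pp * pm) + (pm * (1 - r + 2 * jp) + pp * (s - 1 - 2 * jm))) / \<alpha>" .
    thus ?thesis
      by (simp only: Fock_limit_shift power_int_add[OF disjI1[OF fugacity_nonzero]] power_int_mult mult_ac)
  qed
  hence "(\<Sum>jp\<in>{0..r - 1}. \<Sum>jm\<in>{0..s - 1}. Fock_limit \<epsilon> (\<mu> + of_real (alpha_rsn pp pm (r - 2 * jp) (s - 2 * jm) n)))
     = ?u powi (n * (pp * pm)) * (q_number (?u powi pm) r * q_number (?u powi pp) s) * Fock_limit \<epsilon> \<mu>"
    unfolding q_number_def[of _ r] q_number_reverse[of _ s] sum_product
    by (simp only: sum_distrib_left sum_distrib_right)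
  thus ?thesis by (simp only: mult.assoc)
qed

end

theorem theorem19:
  fixes pp pm :: int and \<epsilon> l \<mu> :: complex and m n r s :: int
  assumes "pp \<ge> 2" and "pm \<ge> 2" and "coprime pp pm"
    and "Re \<epsilon> > B_bound pp pm \<epsilon>" and "Re \<epsilon> \<noteq> 0"
    and "1 \<le> r" and "r \<le> pp" and "1 \<le> s" and "s \<le> pm"
  shows "(\<forall>\<nu>. qdim_exists pp pm \<epsilon> (ch_Fock pp pm \<epsilon> \<nu>)) \<and>
    (\<forall>a\<in>{1..pp}. \<forall>b\<in>{1..pm}. \<forall>c. qdim_exists pp pm \<epsilon> (ch_I pp pm \<epsilon> a b c)) \<and>
    qdim_Fock pp pm \<epsilon> l * qdim_Fock pp pm \<epsilon> \<mu> =
      (\<Sum>jp\<in>{0..pp - 1}. \<Sum>jm\<in>{0..pm - 1}.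
         qdim_Fock pp pm \<epsilon> (l + \<mu> + of_int jp * complex_of_real (alpha_plus pp pm)
                                  + of_int jm * complex_of_real (alpha_minus pp pm))) \<and>
    qdim_I pp pm \<epsilon> r s n * qdim_Fock pp pm \<epsilon> \<mu> =
      (\<Sum>jp\<in>{0..r - 1}. \<Sum>jm\<in>{0..s - 1}.
         qdim_Fock pp pm \<epsilon>
           (\<mu> + complex_of_real (alpha_rsn pp pm (r - 2 * jp) (s - 2 * jm) n))) \<and>
    qdim_I pp pm \<epsilon> 1 1 m * qdim_I pp pm \<epsilon> r s n = qdim_I pp pm \<epsilon> r s (m + n) \<and>
    qdim_I pp pm \<epsilon> 2 1 0 * qdim_I pp pm \<epsilon> r s n =
      (if r = 1 then qdim_I pp pm \<epsilon> 2 s n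
       else if r < pp then qdim_I pp pm \<epsilon> (r - 1) s n + qdim_I pp pm \<epsilon> (r + 1) s n
       else qdim_I pp pm \<epsilon> 1 s (n - 1) + 2 * qdim_I pp pm \<epsilon> (pp - 1) s n
            + qdim_I pp pm \<epsilon> 1 s (n + 1)) \<and>
    qdim_I pp pm \<epsilon> 1 2 0 * qdim_I pp pm \<epsilon> r s n =
      (if s = 1 then qdim_I pp pm \<epsilon> r 2 n
       else if s < pm then qdim_I pp pm \<epsilon> r (s - 1) n + qdim_I pp pm \<epsilon> r (s + 1) n
       else qdim_I pp pm \<epsilon> r 1 (n - 1) + 2 * qdim_I pp pm \<epsilon> r (pm - 1) n
            + qdim_I pp pm \<epsilon> r 1 (n + 1))"
proof -
  interpret singlet pp pm by unfold_locales fact+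
  have adm: "pole_free_cone \<epsilon>" by (rule B_bound_imp_pole_free_cone) fact
  note re = \<open>Re \<epsilon> \<noteq> 0\<close>
  define v where "v = fugacity \<epsilon> powi pm"
  define w where "w = fugacity \<epsilon> powi pp"
  define Q where "Q = fugacity \<epsilon> powi (pp * pm)"
  have I: "qdim_I pp pm \<epsilon> a b c = Q powi c * q_number v a * q_number w b" if "1 \<le> a" "a \<le> pp" "1 \<le> b" "b \<le> pm" for a b c
    unfolding qdim_I_eq[OF adm re that] v_def w_def Q_def power_int_mult [symmetric] by (simp add: mult_ac)
  note F = qdim_Fock_eq[OF adm re]
  have v: "v \<noteq> 0" "v - inverse v \<noteq> 0" and w: "w \<noteq> 0" "w - inverse w \<noteq> 0" and Q: "Q \<noteq> 0"
    using q_number_frac(2)[of \<epsilon> pm 0] q_number_frac(2)[of \<epsilon> pp 0] re pp pm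
    by (auto simp: v_def w_def Q_def power_int_minus)
  have vQ: "v powi pp = Q" "w powi pm = Q"
    by (simp_all add: v_def w_def Q_def mult.commute flip: power_int_mult)
  have Qn: "Q powi (c + 1) = Q powi c * Q" "Q powi (c - 1) = Q powi c * inverse Q" for c
    using Q by (simp_all add: power_int_add power_int_diff divide_inverse)
  have "\<forall>\<nu>. qdim_exists pp pm \<epsilon> (ch_Fock pp pm \<epsilon> \<nu>)"
    using qdim_eqI(1)[OF adm re ch_Fock_tendsto] by blast
  moreover have "\<forall>a\<in>{1..pp}. \<forall>b\<in>{1..pm}. \<forall>c. qdim_exists pp pm \<epsilon> (ch_I pp pm \<epsilon> a b c)"
    using qdim_eqI(1)[OF adm re ch_I_tendsto[OF adm re]] by auto
  moreover have "qdim_Fock pp pm \<epsilon> l * qdim_Fock pp pm \<epsilon> \<mu> =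
      (\<Sum>jp\<in>{0..pp - 1}. \<Sum>jm\<in>{0..pm - 1}.
         qdim_Fock pp pm \<epsilon> (l + \<mu> + of_int jp * complex_of_real (alpha_plus pp pm)
                                  + of_int jm * complex_of_real (alpha_minus pp pm)))"
    unfolding F sum_distrib_right [symmetric] fusion_Fock_Fock [symmetric] by (simp add: mult_ac)
  moreover have "qdim_I pp pm \<epsilon> r s n * qdim_Fock pp pm \<epsilon> \<mu> =
      (\<Sum>jp\<in>{0..r - 1}. \<Sum>jm\<in>{0..s - 1}.
         qdim_Fock pp pm \<epsilon>
           (\<mu> + complex_of_real (alpha_rsn pp pm (r - 2 * jp) (s - 2 * jm) n)))"
    unfolding F sum_distrib_right [symmetric] fusion_I_Fock [symmetric]
    using assms by (subst qdim_I_eq[OF adm re]) (simp_all add: mult_ac)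
  moreover have "qdim_I pp pm \<epsilon> 1 1 m * qdim_I pp pm \<epsilon> r s n = qdim_I pp pm \<epsilon> r s (m + n)"
    using assms Q by (simp add: I power_int_add)
  moreover have "qdim_I pp pm \<epsilon> 2 1 0 * qdim_I pp pm \<epsilon> r s n =
      (if r = 1 then qdim_I pp pm \<epsilon> 2 s n
       else if r < pp then qdim_I pp pm \<epsilon> (r - 1) s n + qdim_I pp pm \<epsilon> (r + 1) s n
       else qdim_I pp pm \<epsilon> 1 s (n - 1) + 2 * qdim_I pp pm \<epsilon> (pp - 1) s n
            + qdim_I pp pm \<epsilon> 1 s (n + 1))"
  proof -
    have "qdim_I pp pm \<epsilon> 2 1 0 * qdim_I pp pm \<epsilon> r s n = Q powi n * (q_number v 2 * q_number v r) * q_number w s"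
      using assms by (simp add: I)
    also have "\<dots> = Q powi n * (q_number v (r - 1) + q_number v (r + 1)) * q_number w s"
      using assms v by (simp add: q_number_2_mult)
    finally have 1: "qdim_I pp pm \<epsilon> 2 1 0 * qdim_I pp pm \<epsilon> r s n = \<dots>" .
    show ?thesis
    proof (cases "r < pp")
      case True
      thus ?thesis unfolding 1 using assms by (auto simp: I algebra_simps q_number_def[of _ 0])
    next
      case False
      thus ?thesis unfolding 1 using assms v
        by (simp add: I q_number_top vQ Qn) (simp add: algebra_simps)
    qed
  qed
  moreover have "qdim_I pp pm \<epsilon> 1 2 0 * qdim_I pp pm \<epsilon> r s n =
      (if s = 1 then qdim_I pp pm \<epsilon> r 2 n
       else if s < pm then qdim_I pp pm \<epsilon> r (s - 1) n + qdim_I pp pm \<epsilon> r (s + 1) n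
       else qdim_I pp pm \<epsilon> r 1 (n - 1) + 2 * qdim_I pp pm \<epsilon> r (pm - 1) n
            + qdim_I pp pm \<epsilon> r 1 (n + 1))"
  proof -
    have "qdim_I pp pm \<epsilon> 1 2 0 * qdim_I pp pm \<epsilon> r s n = Q powi n * q_number v r * (q_number w 2 * q_number w s)"
      using assms by (simp add: I)
    also have "\<dots> = Q powi n * q_number v r * (q_number w (s - 1) + q_number w (s + 1))"
      using assms w by (simp add: q_number_2_mult)
    finally have 1: "qdim_I pp pm \<epsilon> 1 2 0 * qdim_I pp pm \<epsilon> r s n = \<dots>" .
    show ?thesis
    proof (cases "s < pm")
      case True
      thus ?thesis unfolding 1 using assms by (auto simp: I algebra_simps q_number_def[of _ 0])
    next
      case False
      thus ?thesis unfolding 1 using assms w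
        by (simp add: I q_number_top vQ Qn) (simp add: algebra_simps)
    qed
  qed
  ultimately show ?thesis by blast
qed

end
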